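(* There is some $R>0$ such that for any zero $\rho$ of $\mathcal R(s)$ in the fourth quadrant with $|\rho|>R$, there are some real numbers $r>0$ and $0<\epsilon<1$ such that $$\rho=2\pi r^2\exp\Bigl\{i\Bigl(-\frac{\pi}{2}+\frac{\pi}{2\log r}-\frac{\pi^3}{24\log^3 r}+\frac{\pi^3\epsilon}{24\log^4 r}\Bigr)\Bigr\}.$$
   Context: $\mathcal R(s)$ is Riemann's auxiliary function, the entire function defined by $$\mathcal R(s)=\int_{0\swarrow 1}\frac{x^{-s}e^{\pi i x^2}}{e^{\pi i x}-e^{-\pi i x}}\,dx ,$$ where the path is the straight line of direction $e^{i\pi/4}$ crossing the real axis at a point strictly between $0$ and $1$, traversed from upper right to lower left, and $x^{-s}=\exp(-s\log x)$ with the principal logarithm. The fourth quadrant is $\{s\in\mathbb C:\Re s>0,\ \Im s<0\}$. *)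

theory Defs
  imports "HOL-Complex_Analysis.Complex_Analysis"
begin

text \<open>
  The line through \<open>c\<close> of direction \<open>cis (pi / 4)\<close>, parametrised so that increasing \<open>t\<close> runs
  from upper right to lower left; hence the factor \<open>- cis (pi / 4)\<close> coming from \<open>dx\<close> below.
\<close>

definition aux_line :: "real \<Rightarrow> real \<Rightarrow> complex" where
  "aux_line c t = of_real c - of_real t * cis (pi / 4)"

definition aux_integrand :: "complex \<Rightarrow> complex \<Rightarrow> complex" where
  "aux_integrand s x =
     exp (- s * Ln x) * exp (of_real pi * \<i> * x\<^sup>2) /
       (exp (of_real pi * \<i> * x) - exp (- (of_real pi * \<i> * x)))"

text \<open>
  For \<open>0 < c < 1\<close> the line avoids the poles (the integers) and the branch cut of \<open>Ln\<close>, and the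
  integrand decays like \<open>exp (- pi * t\<^sup>2)\<close> up to factors of lower order. The integral therefore
  converges absolutely for every \<open>s\<close>, and by Cauchy's theorem its value does not depend on \<open>c\<close>.
\<close>

definition riemann_aux :: "real \<Rightarrow> complex \<Rightarrow> complex" where
  "riemann_aux c s =
     (LINT t|lborel. aux_integrand s (aux_line c t) * (- cis (pi / 4)))"

end

(* With x0 the saddle point of x^(-s) exp(pi i x^2) in the lower half plane, so that
   s = 2 pi i x0^2, move the line of integration to the right until it (almost) passes through x0,
   crossing the real axis at a half-integer N + 1/2. The residues give R(s) = sum_{n<=N} n^(-s) + I.
   The direction exp(i pi/4) is that of steepest descent at x0, and on the whole line the modulus of
   the integrand is dominated by a Gaussian, so |I| = |exp(-s log x0 + s/2)| up to a factor
   exp(O(r)), where r = |x0|. For s = 2 pi r^2 exp(i(d - pi/2)) the exponent is 2 pi r^2 h(d) with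
   h(d) = cos d (pi - d)/2 - sin d (log r - 1/2). If h(d) >= 1/r then I dominates the finite sum;
   if h(d) <= -1/r then the term n = 1 dominates everything else. So |h(d)| < 1/r at a zero.
   Finally h is decreasing and takes values of size +-(pi/log r)^3/48 at the angles belonging to
   epsilon = 0 and epsilon = 1, which far exceed 1/r and hence enclose d. *)
theory Submission
  imports Defs "HOL-Probability.Characteristic_Functions" "HOL-Real_Asymp.Real_Asymp"
begin

section \<open>Angles with small exponent\<close>

text \<open>The h of the overview is \<open>saddle_height\<close>, a function of
  \<open>L = ln r\<close> and the angle. Its zero satisfies tan d = (pi - d) / (2 L - 1). Expanding
  tan gives 2 L d = pi - (2 L - 1) d^3 / 3 - ..., hence d = pi / (2 L) - pi^3 / (24 L^3) + pi^3 /
  (48 L^4) + ...: the root itself has \<epsilon> close to 1/2, and the values 0 and 1 leave equal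
  room on both sides. The second derivative of the phase at the saddle point is 4 pi i wherever that
  point lies, so straight lines of the given slope serve every s and no curved contour is needed.
  The obstacle is the poles: the line through the saddle point may come arbitrarily close to an
  integer. Shifting it by at most 1/2 costs only a bounded factor. The threshold 1/r comes from the
  denominator of the integrand. At the saddle point its modulus is about exp(pi b) with b <= r,
  which weakens the lower bound for I by that factor, whereas a height of 1/r is worth exp(2 pi
  r).\<close>

definition saddle_height :: "real \<Rightarrow> real \<Rightarrow> real" where
  "saddle_height L d = cos d * (pi - d) / 2 - sin d * (L - 1/2)"

text \<open>The angle of the theorem, measured from the negative imaginary axis, with \<open>L = ln r\<close> and \<open>e\<close> for \<open>\<epsilon>\<close>.\<close>

definition trial_angle :: "real \<Rightarrow> real \<Rightarrow> real" where
  "trial_angle e L = pi / (2 * L) - pi ^ 3 / (24 * L ^ 3) + pi ^ 3 * e / (24 * L ^ 4)"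

text \<open>Here \<open>z\<close> is 1 / L. The two leading coefficients of the trial angle cancel
  every term of the height below order \<open>z ^ 3\<close>, and the limit is the coefficient of
  that order. It changes sign at \<open>e = 1/2\<close>, with values of opposite sign at
  \<open>e = 0\<close> and \<open>e = 1\<close>.\<close>

lemma saddle_height_trial_angle:
  "((\<lambda>z. saddle_height (1 / z) (trial_angle e (1 / z)) / z ^ 3) \<longlongrightarrow> pi ^ 3 * (1/48 - e/24)) (at_right 0)"
proof -
  \<comment> \<open>The trial angle is \<open>z * q z\<close>; \<open>S\<close> and \<open>C\<close>
    are the Taylor remainders of sine and cosine, scaled to have finite limits. With them the
    expansion becomes an exact identity.\<close>
  define q where "q z = pi / 2 - pi ^ 3 * z ^ 2 / 24 + e * pi ^ 3 * z ^ 3 / 24" for z :: real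
  define S where "S d = (sin d - d + d ^ 3 / 6) / d ^ 5" for d :: real
  define C where "C d = (cos d - 1 + d ^ 2 / 2) / d ^ 4" for d :: real
  have q0: "(q \<longlongrightarrow> pi / 2) (at_right 0)"
    unfolding q_def by (auto intro!: tendsto_eq_intros)
  have S0: "(S \<longlongrightarrow> 1 / 120) (at_right 0)" and C0: "(C \<longlongrightarrow> 1 / 24) (at_right 0)"
    unfolding S_def C_def by real_asymp+
  have qpos: "eventually (\<lambda>z. q z > 0) (at_right 0)"
    using order_tendstoD(1)[OF q0, of 0] by simp
  have z0: "((\<lambda>z. z) \<longlongrightarrow> (0::real)) (at_right 0)" by (rule tendsto_ident_at)
  have zpos: "eventually (\<lambda>z::real. z > 0) (at_right 0)"
    by (simp add: eventually_at_right_less)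
  have fl: "filterlim (\<lambda>z. z * q z) (at_right 0) (at_right 0)"
    unfolding filterlim_at using qpos zpos
    by (auto intro!: tendsto_eq_intros z0 q0 elim: eventually_elim2)
  note [tendsto_intros] = filterlim_compose[OF S0 fl] filterlim_compose[OF C0 fl] q0 z0
  \<comment> \<open>The quotient of the claim with all negative powers of \<open>z\<close>
    cancelled, so that its limit follows by substitution.\<close>
  let ?G = "\<lambda>z. (- (pi^3) * z / 24 + e * pi^3 * z^2 / 24) * (q z ^2 / 6 - pi * q z / 6 - pi^2/12)
      - e * pi^3 / 24 + q z ^ 3 / 6 + z * q z ^ 4 * C (z * q z) * (pi - z * q z) / 2
      - z * q z ^ 5 * S (z * q z) + z ^ 2 * q z ^ 5 * S (z * q z) / 2"
  have "(?G \<longlongrightarrow> (- (pi^3) * 0 / 24 + e * pi^3 * 0^2 / 24) * ((pi/2) ^2 / 6 - pi * (pi/2) / 6 - pi^2/12)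
      - e * pi^3 / 24 + (pi/2) ^ 3 / 6 + 0 * (pi/2) ^ 4 * (1/24) * (pi - 0 * (pi/2)) / 2
      - 0 * (pi/2) ^ 5 * (1/120) + 0 ^ 2 * (pi/2) ^ 5 * (1/120) / 2) (at_right 0)"
    by (intro tendsto_intros) auto
  also have "?this \<longleftrightarrow> (?G \<longlongrightarrow> pi ^ 3 * (1/48 - e/24)) (at_right 0)"
    by (simp add: power_divide algebra_simps)
  finally have G: "(?G \<longlongrightarrow> pi ^ 3 * (1/48 - e/24)) (at_right 0)" .
  have "eventually (\<lambda>z. ?G z = saddle_height (1 / z) (trial_angle e (1 / z)) / z ^ 3) (at_right 0)"
    using qpos zpos
  proof eventually_elim
    case (elim z)
    define Q where "Q = q z"
    define d where "d = z * Q"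
    have Q: "Q > 0" and z: "z > 0" using elim by (auto simp: Q_def)
    have d: "d > 0" using Q z by (simp add: d_def)
    have tr: "trial_angle e (1 / z) = d"
      using z unfolding d_def Q_def q_def trial_angle_def
      by (simp add: field_simps eval_nat_numeral)
    have sin: "sin d = d - d ^ 3 / 6 + d ^ 5 * S d"
      using d by (simp add: S_def)
    have cos: "cos d = 1 - d ^ 2 / 2 + d ^ 4 * C d"
      using d by (simp add: C_def)
    have Qd: "pi / 2 - Q = pi ^ 3 * z ^ 2 / 24 - e * pi ^ 3 * z ^ 3 / 24"
      by (simp add: Q_def q_def)
    have "saddle_height (1 / z) d * z =
        z * (1 - d ^ 2 / 2 + d ^ 4 * C d) * (pi - d) / 2 - (d - d ^ 3 / 6 + d ^ 5 * S d) * (1 - z/2)"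
      unfolding saddle_height_def sin cos using z by (simp add: field_simps)
    also have "\<dots> = z * pi / 2 - d - z * d^2 * pi / 4 + d^3 / 6 + z * d^3 / 6 + z * d^4 * C d * (pi - d) / 2
        - d^5 * S d + z * d^5 * S d / 2"
      by (simp add: field_simps eval_nat_numeral)
    \<comment> \<open>The term \<open>pi^3 / 24\<close> is inserted to make the cubic in
      \<open>Q\<close> vanish at pi / 2, which lets a factor \<open>pi / 2 - Q\<close> be split off.
      The compensating term cancels the leading part of \<open>z * (pi / 2 - Q)\<close>.\<close>
    also have "\<dots> = z * (pi / 2 - Q) + z^3 * (Q^3 / 6 - pi * Q^2 / 4 + pi^3 / 24) - z^3 * pi^3 / 24
        + z^4 * (Q^3 / 6 + z * Q^4 * C d * (pi - d) / 2 - z * Q^5 * S d + z^2 * Q^5 * S d / 2)"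
      by (simp add: d_def field_simps eval_nat_numeral)
    also have "Q^3 / 6 - pi * Q^2 / 4 + pi^3 / 24 = - (pi / 2 - Q) * (Q^2 / 6 - pi * Q / 6 - pi^2 / 12)"
      by (simp add: field_simps eval_nat_numeral)
    also have "- (pi / 2 - Q) = z * (- (pi^3) * z / 24 + e * pi^3 * z^2 / 24)"
      unfolding Qd by (simp add: field_simps eval_nat_numeral)
    also have "z * (pi / 2 - Q) + z^3 * (z * (- (pi^3) * z / 24 + e * pi^3 * z^2 / 24) * (Q^2 / 6 - pi * Q / 6 - pi^2 / 12))
        - z^3 * pi^3 / 24 + z^4 * (Q^3 / 6 + z * Q^4 * C d * (pi - d) / 2 - z * Q^5 * S d + z^2 * Q^5 * S d / 2)
        = z ^ 4 * ?G z"
      unfolding Qd d_def Q_def[symmetric] by (simp add: field_simps eval_nat_numeral)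
    finally have E: "saddle_height (1 / z) d * z = z ^ 4 * ?G z" .
    have "saddle_height (1 / z) d / z ^ 3 = saddle_height (1 / z) d * z / z ^ 4"
      using z by (simp add: eval_nat_numeral)
    also have "\<dots> = ?G z"
      unfolding E using z by (intro nonzero_mult_div_cancel_left) simp
    finally show ?case unfolding tr by (rule sym)
  qed
  from Lim_transform_eventually[OF G this] show ?thesis .
qed

text \<open>A height of order (ln r)^-3 outgrows 1/r. The limit pi^3/48 is used only through the
  cruder bound 1/48.\<close>

lemma eventually_saddle_height_lower:
  "eventually (\<lambda>r. saddle_height (ln r) (trial_angle 0 (ln r)) > 1/r) at_top"
proof -
  have lim: "filterlim (\<lambda>r::real. 1 / ln r) (at_right 0) at_top" by real_asymp
  have "eventually (\<lambda>z. saddle_height (1 / z) (trial_angle 0 (1 / z)) / z ^ 3 > 1/48) (at_right 0)"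
    by (rule order_tendstoD(1)[OF saddle_height_trial_angle]) (use pi_gt3 in \<open>simp add: one_less_power\<close>)
  from eventually_compose_filterlim[OF this lim]
  have "eventually (\<lambda>r. saddle_height (ln r) (trial_angle 0 (ln r)) * ln r ^ 3 > 1/48) at_top"
    by (simp add: field_simps)
  moreover have "eventually (\<lambda>r::real. ln r ^ 3 / r < 1/48) at_top" "eventually (\<lambda>r::real. ln r ^ 3 > 0) at_top" by real_asymp+
  ultimately show ?thesis
  proof eventually_elim
    case (elim r)
    from elim(1,2) have "ln r ^ 3 / r < saddle_height (ln r) (trial_angle 0 (ln r)) * ln r ^ 3" by (rule less_trans[rotated])
    then have "(1 / r) * ln r ^ 3 < saddle_height (ln r) (trial_angle 0 (ln r)) * ln r ^ 3" by simp
    with elim(3) show ?case using mult_less_cancel_right_pos by blast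
  qed
qed

lemma eventually_saddle_height_upper:
  "eventually (\<lambda>r. saddle_height (ln r) (trial_angle 1 (ln r)) < -(1/r)) at_top"
proof -
  have lim: "filterlim (\<lambda>r::real. 1 / ln r) (at_right 0) at_top" by real_asymp
  have "eventually (\<lambda>z. saddle_height (1 / z) (trial_angle 1 (1 / z)) / z ^ 3 < -1/48) (at_right 0)"
    by (rule order_tendstoD(2)[OF saddle_height_trial_angle]) (use pi_gt3 in \<open>simp add: one_less_power\<close>)
  from eventually_compose_filterlim[OF this lim]
  have "eventually (\<lambda>r. saddle_height (ln r) (trial_angle 1 (ln r)) * ln r ^ 3 < -1/48) at_top"
    by (simp add: field_simps)
  moreover have "eventually (\<lambda>r::real. ln r ^ 3 / r < 1/48) at_top" "eventually (\<lambda>r::real. ln r ^ 3 > 0) at_top" by real_asymp+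
  ultimately show ?thesis
  proof eventually_elim
    case (elim r)
    from elim(2) have "-1/48 < - (ln r ^ 3 / r)" by simp
    with elim(1) have "saddle_height (ln r) (trial_angle 1 (ln r)) * ln r ^ 3 < - (ln r ^ 3 / r)" by (rule less_trans)
    then have "saddle_height (ln r) (trial_angle 1 (ln r)) * ln r ^ 3 < (-(1 / r)) * ln r ^ 3" by simp
    with elim(3) show ?case using mult_less_cancel_right_pos by blast
  qed
qed

lemma saddle_height_strict_antimono:
  assumes "L \<ge> 1" "0 \<le> x" "x < y" "y \<le> pi/2"
  shows "saddle_height L y < saddle_height L x"
proof (rule DERIV_neg_imp_decreasing_open[where f = "saddle_height L"])
  show "x < y" by fact
  show "\<exists>D. (saddle_height L has_real_derivative D) (at d) \<and> D < 0" if "x < d" "d < y" for d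
  proof (intro exI conjI)
    show "(saddle_height L has_real_derivative (- sin d * (pi - d) / 2 - cos d / 2 - cos d * (L - 1/2))) (at d)"
      unfolding saddle_height_def[abs_def] by (auto intro!: derivative_eq_intros simp: field_simps)
    have "sin d > 0" "cos d > 0" using assms that by (auto intro!: sin_gt_zero cos_gt_zero_pi)
    then have "sin d * (pi - d) > 0" "cos d * (L - 1/2) > 0" using that assms by (auto intro!: mult_pos_pos)
    then show "- sin d * (pi - d) / 2 - cos d / 2 - cos d * (L - 1/2) < 0" using \<open>cos d > 0\<close> by linarith
  qed
  show "continuous_on {x..y} (saddle_height L)"
    unfolding saddle_height_def[abs_def] by (auto intro!: continuous_intros)
qed

section \<open>The integrand on lines of slope one\<close>

abbreviation om :: complex where "om \<equiv> cis (pi / 4)"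

text \<open>This is 2 i sin(pi x).\<close>

definition aux_denom :: "complex \<Rightarrow> complex" where
  "aux_denom x = exp (of_real pi * \<i> * x) - exp (- (of_real pi * \<i> * x))"

lemma aux_integrand_eq:
  "aux_integrand s x = exp (- s * Ln x) * exp (of_real pi * \<i> * x\<^sup>2) / aux_denom x"
  by (simp add: aux_integrand_def aux_denom_def)

lemma om_power2: "om\<^sup>2 = \<i>"
  by (simp add: power2_eq_square cis_mult)

lemma Re_aux_line: "Re (aux_line c t) = c - t * (sqrt 2 / 2)"
  and Im_aux_line: "Im (aux_line c t) = - t * (sqrt 2 / 2)"
  by (simp_all add: aux_line_def cos_45 sin_45)

lemma aux_line_not_nonpos:
  assumes "0 < c" shows "aux_line c t \<notin> \<real>\<^sub>\<le>\<^sub>0"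
  using assms by (auto simp: complex_nonpos_Reals_iff Re_aux_line Im_aux_line)

text \<open>The left side is the distance from the origin to the line: multiplying by
  \<open>cnj (cis (- (pi / 4)))\<close> makes the real part the component normal to the line, which
  is constant along it.\<close>

lemma norm_aux_line_ge: "c * (sqrt 2 / 2) \<le> norm (aux_line c t)"
proof -
  have "c * (sqrt 2 / 2) = Re (aux_line c t * cnj (cis (- (pi / 4))))"
    by (simp add: Re_aux_line Im_aux_line cos_45 sin_45 algebra_simps)
  also have "\<dots> \<le> norm (aux_line c t * cnj (cis (- (pi / 4))))" by (rule complex_Re_le_cmod)
  finally show ?thesis by (simp add: norm_mult)
qed

lemma aux_denom_eq_0_iff: "aux_denom x = 0 \<longleftrightarrow> x \<in> \<int>"
proof -
  have "aux_denom x = 2 * \<i> * sin (of_real pi * x)"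
    unfolding sin_exp_eq aux_denom_def by (simp add: field_simps)
  then have "aux_denom x = 0 \<longleftrightarrow> (\<exists>n::int. of_real pi * x = of_real (of_int n * pi))"
    by (simp add: sin_eq_0)
  also have "\<dots> \<longleftrightarrow> (\<exists>n::int. x = of_int n)"
    by (intro ex_cong1) (auto simp: field_simps)
  finally show ?thesis by (auto simp: Ints_def)
qed

lemma aux_denom_line_neq_0:
  assumes "c \<notin> \<int>" shows "aux_denom (aux_line c t) \<noteq> 0"
proof
  assume "aux_denom (aux_line c t) = 0"
  then obtain n where n: "aux_line c t = of_int n"
    unfolding aux_denom_eq_0_iff by (auto elim: Ints_cases)
  from arg_cong[OF this, of Im] have "t = 0" by (simp add: Im_aux_line)
  with arg_cong[OF n, of Re] have "c = of_int n" by (simp add: Re_aux_line)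
  with assms show False by simp
qed

text \<open>The moduli of the two exponentials depend on \<open>t\<close> only and are reciprocal,
  so the bound is uniform in \<open>c\<close>, including lines that pass through a pole.\<close>

lemma norm_aux_denom_ge_1:
  assumes "1 \<le> \<bar>t\<bar>" shows "1 \<le> norm (aux_denom (aux_line c t))"
proof -
  define y where "y = pi * \<bar>t\<bar> * (sqrt 2 / 2)"
  have "1 \<le> pi * \<bar>t\<bar> * (sqrt 2 / 2)"
  proof -
    have "1 * 1 * (1/2) \<le> (pi/2) * \<bar>t\<bar> * (sqrt 2 / 2)"
      using assms pi_gt3 by (intro mult_mono) auto
    then show ?thesis by simp
  qed
  then have y: "y \<ge> 1" by (simp add: y_def)
  have e: "norm (exp (of_real pi * \<i> * aux_line c t)) = exp (pi * t * (sqrt 2 / 2))"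
     "norm (exp (-(of_real pi * \<i> * aux_line c t))) = exp (- (pi * t * (sqrt 2 / 2)))"
    by (simp_all add: norm_exp_eq_Re Re_aux_line Im_aux_line)
  have "exp y - exp (- y) \<le> norm (aux_denom (aux_line c t))"
  proof (cases "t \<ge> 0")
    case True
    then show ?thesis
      using norm_triangle_ineq2[of "exp (of_real pi * \<i> * aux_line c t)" "exp (- (of_real pi * \<i> * aux_line c t))"]
      unfolding aux_denom_def e y_def by simp
  next
    case False
    then show ?thesis
      using norm_triangle_ineq2[of "exp (-(of_real pi * \<i> * aux_line c t))" "exp (of_real pi * \<i> * aux_line c t)"]
      unfolding aux_denom_def e y_def norm_minus_commute[of "exp (of_real pi * \<i> * aux_line c t)"] by simp
  qed
  moreover have "1 + y \<le> exp y" "exp (- y) \<le> 1" using y exp_ge_add_one_self by auto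
  ultimately show ?thesis using y by linarith
qed

text \<open>The quadratic factor decays like exp(-pi t^2) up to a linear term in the exponent, and
  the logarithm grows at most linearly. Since pi > 3, the linear terms can be absorbed with
  exp(-t^2) left over. Uniformity in \<open>c\<close> serves the short sides of the rectangles
  below.\<close>

lemma norm_aux_numer_le:
  assumes c: "0 < c1"
  shows "\<exists>M\<ge>0. \<forall>c t. c1 \<le> c \<and> c \<le> c2 \<longrightarrow>
    norm (exp (- s * Ln (aux_line c t)) * exp (of_real pi * \<i> * (aux_line c t)\<^sup>2)) \<le> M * exp (- t\<^sup>2)"
proof -
  define K where "K = norm s + sqrt 2 * pi * \<bar>c2\<bar> + norm s * (\<bar>c2\<bar> + sqrt 2 / c1 + pi)"
  have K: "K \<ge> 0" using c by (simp add: K_def)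
  have "norm (exp (- s * Ln (aux_line c t)) * exp (of_real pi * \<i> * (aux_line c t)\<^sup>2)) \<le> exp (K + K ^ 2 / 8) * exp (- t\<^sup>2)"
    if "c1 \<le> c" "c \<le> c2" for c t
  proof -
    define x where "x = aux_line c t"
    have xg: "c1 * (sqrt 2 / 2) \<le> norm x"
    proof -
      have "c1 * (sqrt 2 / 2) \<le> c * (sqrt 2 / 2)" using that by (intro mult_right_mono) auto
      also have "\<dots> \<le> norm x" unfolding x_def by (rule norm_aux_line_ge)
      finally show ?thesis .
    qed
    moreover have "0 < c1 * (sqrt 2 / 2)" using c by simp
    ultimately have x0: "norm x > 0" by linarith
    have xl: "norm x \<le> \<bar>c2\<bar> + \<bar>t\<bar>"
      unfolding x_def aux_line_def using that c
      by (intro order_trans[OF norm_triangle_ineq4]) (auto simp: norm_mult)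
    have "norm (Ln x) \<le> \<bar>Re (Ln x)\<bar> + \<bar>Im (Ln x)\<bar>" by (rule cmod_le)
    also have "\<bar>Im (Ln x)\<bar> \<le> pi"
      
      using x0 Im_Ln_le_pi[of x] mpi_less_Im_Ln[of x] by (auto simp: abs_le_iff)
    also have "Re (Ln x) = ln (norm x)" using x0 by (intro Re_Ln) auto
    also have "\<bar>ln (norm x)\<bar> \<le> norm x + inverse (norm x)"
    proof -
      have i: "inverse (norm x) > 0" using x0 by simp
      have "ln (norm x) \<le> norm x - 1" by (rule ln_le_minus_one[OF x0])
      moreover have "- ln (norm x) \<le> inverse (norm x) - 1"
        using ln_le_minus_one[OF i] x0 by (simp add: ln_inverse)
      ultimately show ?thesis using x0 i by linarith
    qed
    also have "inverse (norm x) \<le> inverse (c1 * (sqrt 2 / 2))"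
      using xg c by (intro le_imp_inverse_le) auto
    also have "inverse (c1 * (sqrt 2 / 2)) = sqrt 2 / c1"
      using c by (simp add: field_simps)
    finally have Ln: "norm (Ln x) \<le> \<bar>c2\<bar> + \<bar>t\<bar> + sqrt 2 / c1 + pi" using xl by simp
    have "norm (exp (- s * Ln x)) \<le> exp (norm (- s * Ln x))" by (rule norm_exp)
    also have "norm (- s * Ln x) \<le> norm s * (\<bar>c2\<bar> + \<bar>t\<bar> + sqrt 2 / c1 + pi)"
      using Ln by (simp add: norm_mult mult_left_mono)
    finally have A: "norm (exp (- s * Ln x)) \<le> exp (norm s * (\<bar>c2\<bar> + \<bar>t\<bar> + sqrt 2 / c1 + pi))" by simp
    have sq: "x\<^sup>2 = of_real (c\<^sup>2) - of_real (2 * c * t) * om + of_real (t\<^sup>2) * \<i>"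
      unfolding om_power2[symmetric] x_def aux_line_def by (simp add: power2_eq_square algebra_simps)
    have "Re (of_real pi * \<i> * x\<^sup>2) = - pi * t\<^sup>2 + sqrt 2 * pi * c * t"
      unfolding sq by (simp add: sin_45 algebra_simps)
    also have "\<dots> \<le> - pi * t\<^sup>2 + sqrt 2 * pi * \<bar>c2\<bar> * \<bar>t\<bar>"
    proof -
      have "c * t \<le> c * \<bar>t\<bar>" using that c by (intro mult_left_mono) auto
      also have "\<dots> \<le> \<bar>c2\<bar> * \<bar>t\<bar>" using that c by (intro mult_right_mono) auto
      finally have "c * t \<le> \<bar>c2\<bar> * \<bar>t\<bar>" .
      then have "(sqrt 2 * pi) * (c * t) \<le> (sqrt 2 * pi) * (\<bar>c2\<bar> * \<bar>t\<bar>)" by (intro mult_left_mono) auto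
      then show ?thesis by (simp add: mult.assoc)
    qed
    finally have B: "norm (exp (of_real pi * \<i> * x\<^sup>2)) \<le> exp (- pi * t\<^sup>2 + sqrt 2 * pi * \<bar>c2\<bar> * \<bar>t\<bar>)"
      by (simp add: norm_exp_eq_Re)
    have "norm (exp (- s * Ln x) * exp (of_real pi * \<i> * x\<^sup>2)) \<le>
      exp (norm s * (\<bar>c2\<bar> + \<bar>t\<bar> + sqrt 2 / c1 + pi)) * exp (- pi * t\<^sup>2 + sqrt 2 * pi * \<bar>c2\<bar> * \<bar>t\<bar>)"
      unfolding norm_mult by (intro mult_mono A B) auto
    also have "\<dots> = exp ((norm s + sqrt 2 * pi * \<bar>c2\<bar>) * \<bar>t\<bar> + norm s * (\<bar>c2\<bar> + sqrt 2 / c1 + pi) - pi * t\<^sup>2)"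
      unfolding exp_add[symmetric] by (simp add: algebra_simps)
    also have "\<dots> \<le> exp (K + K ^ 2 / 8 - t\<^sup>2)"
    proof -
      have "(norm s + sqrt 2 * pi * \<bar>c2\<bar>) * \<bar>t\<bar> \<le> K * \<bar>t\<bar>"
        unfolding K_def using c by (intro mult_right_mono) auto
      moreover have "norm s * (\<bar>c2\<bar> + sqrt 2 / c1 + pi) \<le> K" unfolding K_def by simp
      \<comment> \<open>Two of the three available copies of t^2 absorb the linear term by
        completing a square; the third survives.\<close>
      moreover have "K * \<bar>t\<bar> \<le> 2 * t\<^sup>2 + K ^ 2 / 8"
        using zero_le_power2[of "K - 4 * \<bar>t\<bar>"] by (simp add: power2_eq_square algebra_simps)
      moreover have "3 * t\<^sup>2 \<le> pi * t\<^sup>2" using pi_gt3 by (intro mult_right_mono) auto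
      ultimately show ?thesis unfolding exp_le_cancel_iff by linarith
    qed
    finally show ?thesis by (simp add: x_def exp_add[symmetric])
  qed
  then show ?thesis by (intro exI[of _ "exp (K + K ^ 2 / 8)"]) auto
qed

lemma integrable_exp_minus_square: "integrable lborel (\<lambda>t::real. M * exp (- t\<^sup>2))"
proof -
  have "integrable lborel (\<lambda>t. (M * sqrt pi) * normal_density 0 (1 / sqrt 2) t)"
    by (intro integrable_mult_right integrable_normal_density) simp
  also have "(\<lambda>t. (M * sqrt pi) * normal_density 0 (1 / sqrt 2) t) = (\<lambda>t. M * exp (- t\<^sup>2))"
    by (auto simp: normal_density_def fun_eq_iff real_sqrt_mult real_sqrt_divide power_divide)
  finally show ?thesis .
qed

text \<open>The denominator is bounded below by compactness for |t| <= 1 and by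
  \<open>norm_aux_denom_ge_1\<close> beyond, and the numerator is dominated by a Gaussian.\<close>

lemma integrable_aux_integrand_line:
  assumes "0 < c" "c \<notin> \<int>"
  shows "integrable lborel (\<lambda>t. aux_integrand s (aux_line c t))"
proof -
  have cont: "continuous_on A (\<lambda>t. aux_denom (aux_line c t))" for A
    unfolding aux_denom_def aux_line_def by (intro continuous_intros)
  have "\<exists>m>0. \<forall>t\<in>{-1..1}. m \<le> norm (aux_denom (aux_line c t))"
  proof -
    have "\<exists>t0\<in>{-1..1::real}. \<forall>t\<in>{-1..1}. norm (aux_denom (aux_line c t0)) \<le> norm (aux_denom (aux_line c t))"
      by (intro continuous_attains_inf continuous_intros cont) auto
    then show ?thesis using aux_denom_line_neq_0[OF assms(2)] by (metis zero_less_norm_iff)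
  qed
  then obtain m0 where m0: "m0 > 0" "\<And>t. t \<in> {-1..1} \<Longrightarrow> m0 \<le> norm (aux_denom (aux_line c t))" by blast
  define m where "m = min m0 1"
  have m: "m > 0" "m \<le> norm (aux_denom (aux_line c t))" for t
  proof -
    show "m > 0" using m0 by (simp add: m_def)
    show "m \<le> norm (aux_denom (aux_line c t))"
      using m0(2)[of t] norm_aux_denom_ge_1[of t c] by (cases "\<bar>t\<bar> \<le> 1") (auto simp: m_def abs_le_iff min_le_iff_disj)
  qed
  obtain M where M: "M \<ge> 0" "\<And>t. norm (exp (- s * Ln (aux_line c t)) * exp (of_real pi * \<i> * (aux_line c t)\<^sup>2)) \<le> M * exp (- t\<^sup>2)"
    using norm_aux_numer_le[OF assms(1), of c s] by blast
  show ?thesis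
  proof (rule Bochner_Integration.integrable_bound[OF integrable_exp_minus_square[of "M / m"]])
    have "continuous_on UNIV (\<lambda>t. aux_integrand s (aux_line c t))"
      unfolding aux_integrand_eq
      by (intro continuous_intros cont)
         (use aux_line_not_nonpos[OF assms(1)] aux_denom_line_neq_0[OF assms(2)] in
            \<open>auto simp: aux_line_def intro!: continuous_intros\<close>)
    then show "(\<lambda>t. aux_integrand s (aux_line c t)) \<in> borel_measurable lborel"
      by (simp add: borel_measurable_continuous_onI)
    show "AE t in lborel. norm (aux_integrand s (aux_line c t)) \<le> norm (M / m * exp (- t\<^sup>2))"
    proof (rule AE_I2)
      fix t
      have "norm (aux_integrand s (aux_line c t)) \<le> (M * exp (- t\<^sup>2)) / m"
        unfolding aux_integrand_eq norm_divide using M m by (intro frac_le) auto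
      also have "\<dots> = norm (M / m * exp (- t\<^sup>2))" using M(1) m(1) by (simp add: abs_mult)
      finally show "norm (aux_integrand s (aux_line c t)) \<le> norm (M / m * exp (- t\<^sup>2))" .
    qed
  qed
qed

section \<open>Moving the line of integration across the poles\<close>

lemma has_contour_integral_linepath_same_Im_iff:
  fixes a b :: complex
  assumes "Im a = y" "Im b = y" "Re a < Re b"
  shows "(f has_contour_integral I) (linepath a b) \<longleftrightarrow>
         ((\<lambda>x. f (Complex x y)) has_integral I) {Re a..Re b}"
proof -
  have eq: "linepath a b t = linepath (of_real (Re a)) (of_real (Re b)) t + of_real y * \<i>" for t
    using assms by (simp add: linepath_def complex_eq_iff algebra_simps)
  have ba: "b - a = of_real (Re b) - of_real (Re a)"
    using assms by (simp add: complex_eq_iff)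
  have "(f has_contour_integral I) (linepath a b) \<longleftrightarrow>
     ((\<lambda>w. f (w + of_real y * \<i>)) has_contour_integral I) (linepath (of_real (Re a)) (of_real (Re b)))"
    unfolding has_contour_integral_linepath eq ba ..
  also have "\<dots> \<longleftrightarrow> ((\<lambda>x. f (of_real x + of_real y * \<i>)) has_integral I) {Re a..Re b}"
    using assms by (subst has_contour_integral_linepath_Reals_iff) auto
  also have "(\<lambda>x. f (of_real x + of_real y * \<i>)) = (\<lambda>x. f (Complex x y))"
    by (simp add: Complex_eq mult.commute)
  finally show ?thesis .
qed

text \<open>This links the gauge integrals over the sides of growing rectangles to the Lebesgue
  integral in \<open>riemann_aux\<close>.\<close>

lemma tendsto_integral_symmetric_interval:
  fixes g :: "real \<Rightarrow> complex"
  assumes g: "integrable lborel g"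
  shows "((\<lambda>T. integral {-T..T} g) \<longlongrightarrow> (LINT x|lborel. g x)) at_top"
proof -
  have "((\<lambda>T. LINT x|lborel. indicator {-T..T} x *\<^sub>R g x) \<longlongrightarrow> (LINT x|lborel. g x)) at_top"
  proof (rule integral_dominated_convergence_at_top)
    show "integrable lborel (\<lambda>x. norm (g x))" using g by simp
    show "g \<in> borel_measurable lborel" using g by simp
    show "(\<lambda>x. indicat_real {- t..t} x *\<^sub>R g x) \<in> borel_measurable lborel" for t
      using g by simp
    show "\<forall>\<^sub>F t in at_top. AE x in lborel. norm (indicat_real {- t..t} x *\<^sub>R g x) \<le> norm (g x)"
      by (auto simp: indicator_def)
    show "AE x in lborel. ((\<lambda>t. indicat_real {- t..t} x *\<^sub>R g x) \<longlongrightarrow> g x) at_top"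
    proof (rule AE_I2)
      fix x :: real
      have "eventually (\<lambda>t. indicat_real {- t..t} x *\<^sub>R g x = g x) at_top"
        using eventually_ge_at_top[of "\<bar>x\<bar>"] by eventually_elim (auto simp: indicator_def abs_le_iff)
      then show "((\<lambda>t. indicat_real {- t..t} x *\<^sub>R g x) \<longlongrightarrow> g x) at_top"
        by (rule tendsto_eventually)
    qed
  qed
  moreover have "(LINT x|lborel. indicator {-T..T} x *\<^sub>R g x) = integral {-T..T} g" for T
    using set_borel_integral_eq_integral(2)[of "{-T..T}" g] g
    by (simp add: set_lebesgue_integral_def set_integrable_def integrable_mult_indicator)
  ultimately show ?thesis by simp
qed

lemma om_mult_Complex: "om * Complex u (- (c * (sqrt 2 / 2))) = aux_line c (c * (sqrt 2 / 2) - u)"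
  by (simp add: complex_eq_iff Re_aux_line Im_aux_line cos_45 sin_45 field_simps)

text \<open>Rotating by \<open>om\<close> makes the lines of integration horizontal, so that the residue theorem can be applied to axis-parallel rectangles.\<close>

definition rot_integrand :: "complex \<Rightarrow> complex \<Rightarrow> complex" where
  "rot_integrand s w = aux_integrand s (om * w) * om"

text \<open>The minus sign is one of orientation: increasing \<open>u\<close> runs from lower left
  to upper right, against the direction of \<open>aux_line\<close>.\<close>

lemma rot_integrand_line:
  assumes "0 < c" "c \<notin> \<int>"
  shows "integrable lborel (\<lambda>u. rot_integrand s (Complex u (- (c * (sqrt 2 / 2)))))"
    and "(LINT u|lborel. rot_integrand s (Complex u (- (c * (sqrt 2 / 2))))) = - riemann_aux c s"
proof -
  let ?k = "c * (sqrt 2 / 2)" and ?g = "\<lambda>t. aux_integrand s (aux_line c t) * om"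
  have g: "integrable lborel ?g" using integrable_aux_integrand_line[OF assms] by simp
  have eq: "(\<lambda>u. rot_integrand s (Complex u (- ?k))) = (\<lambda>u. ?g (?k + (-1) * u))"
    unfolding rot_integrand_def om_mult_Complex by simp
  show "integrable lborel (\<lambda>u. rot_integrand s (Complex u (- ?k)))"
    unfolding eq by (rule lborel_integrable_real_affine[OF g]) simp
  have "(LINT u|lborel. ?g u) = \<bar>-1\<bar> *\<^sub>R (LINT u|lborel. ?g (?k + (-1) * u))"
    by (rule lborel_integral_real_affine) simp
  then show "(LINT u|lborel. rot_integrand s (Complex u (- ?k))) = - riemann_aux c s"
    unfolding eq riemann_aux_def by simp
qed

lemma Re_om_inverse: "Re (of_real a / om) = a * (sqrt 2 / 2)" and Im_om_inverse: "Im (of_real a / om) = - a * (sqrt 2 / 2)"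
  by (simp_all add: divide_complex_def cis_inverse cos_45 sin_45)

text \<open>Rotated back, the lower half plane is the side Re x > Im x of the diagonal, which misses
  the branch cut.\<close>

lemma om_mult_nonpos:
  assumes "Im w < 0" shows "om * w \<notin> \<real>\<^sub>\<le>\<^sub>0"
proof
  assume "om * w \<in> \<real>\<^sub>\<le>\<^sub>0"
  then obtain a where a: "om * w = of_real a" "a \<le> 0" by (auto elim: nonpos_Reals_cases)
  then have "w = of_real a / om" by (simp add: field_simps)
  then have "Im w = - a * (sqrt 2 / 2)" using Im_om_inverse by simp
  then have "Im w \<ge> 0" using a by (simp add: mult_nonpos_nonneg)
  with assms show False by simp
qed

lemma rot_integrand_holomorphic:
  "rot_integrand s holomorphic_on {w. - ((of_nat N + 1) * (sqrt 2 / 2)) < Im w \<and> Im w < 0} - (\<lambda>n. of_nat n / om) ` {1..N}"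
proof -
  let ?S = "{w. - ((of_nat N + 1) * (sqrt 2 / 2)) < Im w \<and> Im w < 0} - (\<lambda>n. of_nat n / om) ` {1..N}"
  have d: "aux_denom (om * w) \<noteq> 0" if "w \<in> ?S" for w
  proof
    assume "aux_denom (om * w) = 0"
    then obtain m where "om * w = of_int m" unfolding aux_denom_eq_0_iff by (auto elim: Ints_cases)
    then have w: "w = of_real (of_int m) / om" by (simp add: field_simps)
    then have "Im w = - of_int m * (sqrt 2 / 2)" using Im_om_inverse[of "of_int m"] by simp
    with that have "0 < of_int m * (sqrt 2 / 2)" "of_int m * (sqrt 2 / 2) < (of_nat N + 1) * (sqrt 2 / 2)" by auto
    moreover have "sqrt 2 / 2 > (0::real)" by simp
    ultimately have "m > 0" "of_int m < (of_nat N + 1 :: real)"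
      using zero_less_mult_pos2[of "of_int m" "sqrt 2 / 2"] mult_right_less_imp_less[of "of_int m" "sqrt 2 / 2" "of_nat N + 1"]
      by linarith+
    then have "nat m \<in> {1..N}" and "w = of_nat (nat m) / om" using w by auto
    with that show False by blast
  qed
  have n: "om * w \<notin> \<real>\<^sub>\<le>\<^sub>0" if "w \<in> ?S" for w using that om_mult_nonpos[of w] by auto
  show ?thesis
    unfolding rot_integrand_def[abs_def] aux_integrand_eq
    using d n by (intro holomorphic_intros) (auto simp: aux_denom_def[abs_def] intro!: holomorphic_intros)
qed

text \<open>The numerator contributes exp(pi i n^2) = (-1)^n, which cancels the sign in the
  derivative of the denominator, 2 pi i (-1)^n; the factor \<open>om\<close> from the rotation
  cancels too. What remains is n^(-s) / (2 pi i).\<close>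

lemma residue_rot_integrand:
  assumes "n \<ge> 1"
  shows "residue (rot_integrand s) (of_nat n / om) = exp (- s * of_real (ln (real n))) / (2 * of_real pi * \<i>)"
proof -
  let ?z = "of_nat n / om" and ?S = "{w. Im w < 0}"
  have z: "om * ?z = of_nat n" by simp
  have Imz: "Im ?z < 0" using Im_om_inverse[of "real n"] assms by simp
  have eq: "rot_integrand s = (\<lambda>w. (exp (- s * Ln (om * w)) * exp (of_real pi * \<i> * (om * w)\<^sup>2) * om) / aux_denom (om * w))"
    by (simp add: rot_integrand_def aux_integrand_eq fun_eq_iff)
  have sgn: "exp (of_real pi * \<i> * of_nat k) = (-1) ^ k" for k
    by (metis exp_of_nat2_mult exp_pi_i)
  have sgn': "exp (- (of_real pi * \<i> * of_nat k)) = (-1) ^ k" for k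
    unfolding exp_minus sgn by (simp add: power_inverse[symmetric])
  have "residue (rot_integrand s) ?z = (exp (- s * Ln (om * ?z)) * exp (of_real pi * \<i> * (om * ?z)\<^sup>2) * om) /
      (of_real pi * \<i> * om * (exp (of_real pi * \<i> * (om * ?z)) + exp (- (of_real pi * \<i> * (om * ?z)))))"
    unfolding eq
  proof (rule residue_simple_pole_deriv[where s = ?S])
    show "(\<lambda>w. exp (- s * Ln (om * w)) * exp (of_real pi * \<i> * (om * w)\<^sup>2) * om) holomorphic_on ?S"
      by (intro holomorphic_intros) (use om_mult_nonpos in auto)
    show "(\<lambda>w. aux_denom (om * w)) holomorphic_on ?S"
      unfolding aux_denom_def by (intro holomorphic_intros)
    show "open ?S" by (rule open_halfspace_Im_lt)
    show "connected ?S" by (intro convex_connected convex_halfspace_Im_lt)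
    show "?z \<in> ?S" using Imz by simp
    show "((\<lambda>w. aux_denom (om * w)) has_field_derivative of_real pi * \<i> * om * (exp (of_real pi * \<i> * (om * ?z)) + exp (- (of_real pi * \<i> * (om * ?z))))) (at ?z)"
      unfolding aux_denom_def by (auto intro!: derivative_eq_intros simp: algebra_simps)
    show "aux_denom (om * ?z) = 0" unfolding z aux_denom_eq_0_iff by simp
    show "of_real pi * \<i> * om * (exp (of_real pi * \<i> * (om * ?z)) + exp (- (of_real pi * \<i> * (om * ?z)))) \<noteq> 0"
      unfolding z sgn sgn' by simp
  qed simp
  also have "\<dots> = exp (- s * Ln (of_nat n)) * (-1) ^ (n^2) / (2 * of_real pi * \<i> * (-1) ^ n)"
    unfolding z sgn sgn' of_nat_power[symmetric] by (simp add: field_simps)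
  also have "(-1) ^ (n^2) = ((-1) ^ n :: complex)" by (cases "even n") auto
  also have "Ln (of_nat n) = of_real (ln (real n))" using assms by (simp add: Ln_of_nat)
  finally show ?thesis by simp
qed

lemma aux_integrand_far:
  assumes "0 < c1"
  shows "\<exists>M\<ge>0. \<forall>c t. c1 \<le> c \<and> c \<le> c2 \<and> 1 \<le> \<bar>t\<bar> \<longrightarrow> norm (aux_integrand s (aux_line c t)) \<le> M * exp (- t\<^sup>2)"
proof -
  obtain M where M: "M \<ge> 0" "\<And>c t. c1 \<le> c \<Longrightarrow> c \<le> c2 \<Longrightarrow>
    norm (exp (- s * Ln (aux_line c t)) * exp (of_real pi * \<i> * (aux_line c t)\<^sup>2)) \<le> M * exp (- t\<^sup>2)"
    using norm_aux_numer_le[OF assms, of c2 s] by blast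
  have "norm (aux_integrand s (aux_line c t)) \<le> M * exp (- t\<^sup>2) / 1"
    if "c1 \<le> c" "c \<le> c2" "1 \<le> \<bar>t\<bar>" for c t
    unfolding aux_integrand_eq norm_divide
    using M that norm_aux_denom_ge_1[of t c] by (intro frac_le) auto
  then show ?thesis using M(1) by auto
qed

text \<open>Residue theorem on rectangles of half-width \<open>T\<close> in the rotated plane: the
  upper side is the old line, the lower side the new one, and the rotated poles of 1, ..., N lie
  inside. The vertical sides vanish as \<open>T\<close> grows.\<close>

lemma riemann_aux_shift:
  assumes c: "0 < c" "c < 1" and N: "N \<ge> 1"
  shows "riemann_aux c s = (\<Sum>n=1..N. exp (- s * of_real (ln (real n)))) + riemann_aux (of_nat N + 1/2) s"
proof -
  define k where "k = sqrt 2 / (2::real)"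
  have k: "k > 0" "k \<le> 1" by (simp_all add: k_def sqrt2_less_2 less_imp_le)
  define c' where "c' = of_nat N + (1/2 :: real)"
  have c': "c < c'" "c' > 0" using c N by (auto simp: c'_def)
  have ni: "c \<notin> \<int>" "c' \<notin> \<int>"
  proof -
    show "c \<notin> \<int>" using c by (auto elim!: Ints_cases)
    show "c' \<notin> \<int>"
    proof
      assume "c' \<in> \<int>"
      then have "c' - of_nat N \<in> \<int>" by (intro Ints_diff) auto
      then show False by (auto simp: c'_def elim!: Ints_cases)
    qed
  qed
  let ?F = "rot_integrand s"
  define Lo where "Lo T = integral {-T..T} (\<lambda>u. ?F (Complex u (- (c' * k))))" for T
  define Up where "Up T = integral {-T..T} (\<lambda>u. ?F (Complex u (- (c * k))))" for T
  have Lo: "(Lo \<longlongrightarrow> - riemann_aux c' s) at_top" and Up: "(Up \<longlongrightarrow> - riemann_aux c s) at_top"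
    unfolding Lo_def Up_def k_def
    using tendsto_integral_symmetric_interval[OF rot_integrand_line(1)]
      rot_integrand_line(2) c c' ni by fastforce+
  obtain M where M: "M \<ge> 0" "\<And>x t. c \<le> x \<Longrightarrow> x \<le> c' \<Longrightarrow> 1 \<le> \<bar>t\<bar> \<Longrightarrow> norm (aux_integrand s (aux_line x t)) \<le> M * exp (- t\<^sup>2)"
    using aux_integrand_far[OF c(1), of c' s] by blast
  define D where "D = (\<Sum>n=1..N. exp (- s * of_real (ln (real n))))"
  \<comment> \<open>With \<open>T > c' + 1\<close> all the enclosed poles lie to the left of the
    right-hand side, and on both vertical sides the line parameter has modulus at least 1, where
    \<open>aux_integrand_far\<close> applies.\<close>
  have main: "norm (Lo T - Up T - D) \<le> 2 * (M * exp (- (T - c')\<^sup>2) * c')" if T: "T > c' + 1" for T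
  proof -
    define a1 a2 a3 a4 where "a1 = Complex (-T) (- (c' * k))" and "a2 = Complex T (- (c' * k))"
      and "a3 = Complex T (- (c * k))" and "a4 = Complex (-T) (- (c * k))"
    note adefs = a1_def a2_def a3_def a4_def
    define S where "S = {w. - ((of_nat N + 1) * k) < Im w \<and> Im w < 0}"
    define P where "P = (\<lambda>n. of_nat n / om) ` {1..N}"
    have T0: "T > 0" using T c' by simp
    have ck: "c * k < c' * k" "0 < c * k" "c' * k < (of_nat N + 1) * k" using c c' k by (auto simp: c'_def)
    have nk: "c * k < of_nat n * k" "of_nat n * k < c' * k" "of_nat n * k < T" if "n \<in> {1..N}" for n
    proof -
      have "c < of_nat n" "of_nat n < c'" using that c by (auto simp: c'_def)
      then show 1: "c * k < of_nat n * k" "of_nat n * k < c' * k" using k by auto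
      have "of_nat n * k \<le> of_nat n * 1" using k by (intro mult_left_mono) auto
      then show "of_nat n * k < T" using T \<open>of_nat n < c'\<close> by simp
    qed
    have inbox: "of_nat n / om \<in> box a1 a3" if "n \<in> {1..N}" for n
    proof -
      have "Re (of_nat n / om) = of_nat n * k" "Im (of_nat n / om) = - (of_nat n * k)"
        using Re_om_inverse[of n] Im_om_inverse[of n] by (simp_all add: k_def)
      moreover have "- T < of_nat n * k" using T0 k by (rule_tac less_le_trans[of _ 0]) auto
      ultimately show ?thesis using nk[OF that]
        unfolding in_box_complex_iff adefs complex.sel greaterThanLessThan_iff by (intro conjI; linarith)
    qed
    have rp: "rectpath a1 a3 = linepath a1 a2 +++ linepath a2 a3 +++ linepath a3 a4 +++ linepath a4 a1"
      by (simp add: rectpath_def adefs Let_def)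
    have cb: "cbox a1 a3 \<subseteq> S"
      using ck by (auto simp: in_cbox_complex_iff S_def adefs)
    have pi: "path_image (rectpath a1 a3) \<subseteq> S - P"
      using path_image_rectpath_subset_cbox[of a1 a3] path_image_rectpath_inter_box[of a1 a3] cb inbox T0 ck
      unfolding P_def by (auto simp: adefs)
    have oS: "open S" "convex S"
    proof -
      have S: "S = {w. Im w > - ((of_nat N + 1) * k)} \<inter> {w. Im w < 0}" by (auto simp: S_def)
      show "open S" unfolding S by (intro open_Int open_halfspace_Im_gt open_halfspace_Im_lt)
      show "convex S" unfolding S by (intro convex_Int convex_halfspace_Im_gt convex_halfspace_Im_lt)
    qed
    have holo: "?F holomorphic_on S - P"
      using rot_integrand_holomorphic[of s N] by (simp add: S_def P_def k_def)
    have "contour_integral (rectpath a1 a3) ?F = 2 * pi * \<i> * (\<Sum>p\<in>P. winding_number (rectpath a1 a3) p * residue ?F p)"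
    proof (rule Residue_theorem[where S = S])
      show "\<forall>z. z \<notin> S \<longrightarrow> winding_number (rectpath a1 a3) z = 0"
        using cb T0 ck by (auto intro!: winding_number_rectpath_outside simp: adefs)
    qed (use oS pi holo convex_connected in \<open>auto simp: P_def\<close>)
    also have "(\<Sum>p\<in>P. winding_number (rectpath a1 a3) p * residue ?F p) = (\<Sum>p\<in>P. residue ?F p)"
      by (intro sum.cong) (auto simp: P_def inbox winding_number_rectpath)
    also have "\<dots> = (\<Sum>n=1..N. residue ?F (of_nat n / om))"
      unfolding P_def by (subst sum.reindex) (auto simp: inj_on_def)
    also have "2 * pi * \<i> * \<dots> = D"
      unfolding sum_distrib_left D_def by (intro sum.cong refl, subst residue_rot_integrand) auto
    finally have total: "contour_integral (rectpath a1 a3) ?F = D" .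
    have cont: "continuous_on (path_image (rectpath a1 a3)) ?F"
      using holo pi by (meson holomorphic_on_imp_continuous_on continuous_on_subset)
    have imgs: "closed_segment a1 a2 \<subseteq> path_image (rectpath a1 a3)" "closed_segment a2 a3 \<subseteq> path_image (rectpath a1 a3)"
      "closed_segment a3 a4 \<subseteq> path_image (rectpath a1 a3)" "closed_segment a4 a1 \<subseteq> path_image (rectpath a1 a3)"
      unfolding rp by (auto simp: path_image_join)
    have ints: "?F contour_integrable_on linepath a1 a2" "?F contour_integrable_on linepath a2 a3"
      "?F contour_integrable_on linepath a3 a4" "?F contour_integrable_on linepath a4 a1"
      by (rule contour_integrable_continuous_linepath, rule continuous_on_subset[OF cont], rule imgs)+
    have sum4: "D = contour_integral (linepath a1 a2) ?F + contour_integral (linepath a2 a3) ?F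
       + contour_integral (linepath a3 a4) ?F + contour_integral (linepath a4 a1) ?F"
      unfolding total[symmetric] rp using ints by (simp add: contour_integrable_joinI valid_path_join)
    have I12: "contour_integral (linepath a1 a2) ?F = Lo T"
    proof -
      have "(?F has_contour_integral contour_integral (linepath a1 a2) ?F) (linepath a1 a2)"
        using ints(1) by (rule has_contour_integral_integral)
      then have "((\<lambda>x. ?F (Complex x (- (c' * k)))) has_integral contour_integral (linepath a1 a2) ?F) {-T..T}"
        by (subst (asm) has_contour_integral_linepath_same_Im_iff[where y = "- (c' * k)"]) (use T0 in \<open>auto simp: adefs\<close>)
      then show ?thesis unfolding Lo_def by (simp add: integral_unique)
    qed
    have I34: "contour_integral (linepath a3 a4) ?F = - Up T"
    proof -
      have i: "?F contour_integrable_on linepath a4 a3"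
        using ints(3) by (metis contour_integrable_reversepath reversepath_linepath valid_path_linepath)
      then have "(?F has_contour_integral contour_integral (linepath a4 a3) ?F) (linepath a4 a3)"
        by (rule has_contour_integral_integral)
      then have "((\<lambda>x. ?F (Complex x (- (c * k)))) has_integral contour_integral (linepath a4 a3) ?F) {-T..T}"
        by (subst (asm) has_contour_integral_linepath_same_Im_iff[where y = "- (c * k)"]) (use T0 in \<open>auto simp: adefs\<close>)
      then have "contour_integral (linepath a4 a3) ?F = Up T" unfolding Up_def by (simp add: integral_unique)
      moreover have "contour_integral (linepath a3 a4) ?F = - contour_integral (linepath a4 a3) ?F"
        by (metis contour_integral_reversepath reversepath_linepath valid_path_linepath)
      ultimately show ?thesis by simp
    qed
    have bd: "norm (?F (Complex u (- v))) \<le> M * exp (- (T - c')\<^sup>2)" if "\<bar>u\<bar> = T" "c * k \<le> v" "v \<le> c' * k" for u v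
    proof -
      \<comment> \<open>The point at height \<open>- v\<close> lies on the rotated line that crosses
        the real axis at \<open>x\<close>, with parameter \<open>x * k - u\<close>.\<close>
      define x where "x = v / k"
      have x: "v = x * k" "c \<le> x" "x \<le> c'" using that k by (auto simp: x_def field_simps)
      have xk: "0 \<le> x * k" "x * k \<le> c'"
      proof -
        show "0 \<le> x * k" using x c k by auto
        have "x * k \<le> x * 1" using x c k by (intro mult_left_mono) auto
        then show "x * k \<le> c'" using x by simp
      qed
      then have t: "T - c' \<le> \<bar>x * k - u\<bar>" using that by (auto simp: abs_if split: if_splits)
      have "norm (?F (Complex u (- v))) = norm (aux_integrand s (aux_line x (x * k - u)))"
        unfolding rot_integrand_def x(1) using om_mult_Complex[of u x] by (simp add: k_def norm_mult)
      also have "\<dots> \<le> M * exp (- (x * k - u)\<^sup>2)"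
        using t T x by (intro M) auto
      also have "\<dots> \<le> M * exp (- (T - c')\<^sup>2)"
      proof -
        have "(T - c')\<^sup>2 \<le> \<bar>x * k - u\<bar>\<^sup>2" using t T by (intro power_mono) auto
        then show ?thesis using M(1) by (intro mult_left_mono) auto
      qed
      finally show ?thesis .
    qed
    have side: "norm (contour_integral (linepath (Complex u v1) (Complex u v2)) ?F) \<le> M * exp (- (T - c')\<^sup>2) * c'"
      if i: "?F contour_integrable_on linepath (Complex u v1) (Complex u v2)" and "\<bar>u\<bar> = T"
       "v1 \<in> {- (c' * k).. - (c * k)}" "v2 \<in> {- (c' * k).. - (c * k)}" for u v1 v2
    proof -
      have "norm (contour_integral (linepath (Complex u v1) (Complex u v2)) ?F) \<le> M * exp (- (T - c')\<^sup>2) * norm (Complex u v2 - Complex u v1)"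
      proof (rule contour_integral_bound_linepath[OF i])
        fix w assume "w \<in> closed_segment (Complex u v1) (Complex u v2)"
        then have "Re w = u" "Im w \<in> closed_segment v1 v2" by (auto simp: closed_segment_same_Re)
        then have "w = Complex u (- (- Im w))" "- Im w \<in> {c * k..c' * k}" using that
          by (auto simp: closed_segment_eq_real_ivl complex_eq_iff split: if_splits)
        then show "norm (?F w) \<le> M * exp (- (T - c')\<^sup>2)" using bd[OF \<open>\<bar>u\<bar> = T\<close>, of "- Im w"] by auto
      qed (use M in auto)
      also have "norm (Complex u v2 - Complex u v1) = \<bar>v2 - v1\<bar>" by (simp add: cmod_def)
      also have "\<bar>v2 - v1\<bar> \<le> c' * k" using that ck by auto
      also have "c' * k \<le> c' * 1" using c' k by (intro mult_left_mono) auto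
      finally show ?thesis using M(1) by (simp add: mult_left_mono)
    qed
    have "norm (contour_integral (linepath a2 a3) ?F) \<le> M * exp (- (T - c')\<^sup>2) * c'"
      using ints(2) T0 ck unfolding adefs by (intro side) auto
    moreover have "norm (contour_integral (linepath a4 a1) ?F) \<le> M * exp (- (T - c')\<^sup>2) * c'"
      using ints(4) T0 ck unfolding adefs by (intro side) auto
    moreover have "Lo T - Up T - D = - (contour_integral (linepath a2 a3) ?F + contour_integral (linepath a4 a1) ?F)"
      unfolding sum4 I12 I34 by simp
    ultimately show ?thesis
      by (metis norm_minus_cancel norm_triangle_le add_mono mult_2)
  qed
  have "((\<lambda>T. Lo T - Up T - D) \<longlongrightarrow> 0) at_top"
  proof (rule Lim_null_comparison)
    show "eventually (\<lambda>T. norm (Lo T - Up T - D) \<le> 2 * (M * exp (- (T - c')\<^sup>2) * c')) at_top"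
      using eventually_gt_at_top[of "c' + 1"] by eventually_elim (rule main)
    have "((\<lambda>T. exp (- (T - c')\<^sup>2)) \<longlongrightarrow> 0) at_top" by real_asymp
    from tendsto_mult_right_zero[OF this, of "2 * M * c'"]
    show "((\<lambda>T. 2 * (M * exp (- (T - c')\<^sup>2) * c')) \<longlongrightarrow> 0) at_top"
      by (simp add: mult_ac)
  qed
  moreover have "((\<lambda>T. Lo T - Up T - D) \<longlongrightarrow> - riemann_aux c' s - (- riemann_aux c s) - D) at_top"
    by (intro tendsto_intros Lo Up)
  ultimately have "- riemann_aux c' s - (- riemann_aux c s) - D = 0"
    using tendsto_unique[OF trivial_limit_at_top_linorder] by blast
  then show ?thesis by (simp add: D_def c'_def algebra_simps)
qed

section \<open>Preliminaries for the saddle point estimate\<close>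

definition phase :: "complex \<Rightarrow> complex \<Rightarrow> complex" where
  "phase s x = - s * Ln x + of_real pi * \<i> * x\<^sup>2"

lemma phase_deriv:
  assumes "x \<notin> \<real>\<^sub>\<le>\<^sub>0" "s = 2 * of_real pi * \<i> * x0\<^sup>2"
  shows "(phase s has_field_derivative (2 * of_real pi * \<i> * (x\<^sup>2 - x0\<^sup>2) / x)) (at x within S)"
proof -
  have "x \<noteq> 0" using assms(1) by auto
  then show ?thesis
    unfolding phase_def[abs_def] using assms
    by (auto intro!: derivative_eq_intros simp: field_simps power2_eq_square)
qed

lemma norm_exp_diff_le:
  fixes z w :: complex
  assumes "Re z \<le> B" "Re w \<le> B"
  shows "norm (exp z - exp w) \<le> exp B * norm (z - w)"
proof (rule field_differentiable_bound[where S = "{x. Re x \<le> B}" and f = exp and f' = exp])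
  show "convex {x. Re x \<le> B}" by (rule convex_halfspace_Re_le)
qed (use assms in \<open>auto intro!: derivative_eq_intros simp: norm_exp_eq_Re\<close>)

text \<open>Modulus and argument are tied to the same \<open>a\<close>. If |a| <= pi/2 the cosine is
  nonnegative and the norm is at least 1; otherwise exp a is at least 2 or at most 1/2, hence away
  from 1 whatever the argument. On a slope-one line crossing the real axis at a half-integer this
  keeps the denominator away from 0.\<close>

lemma norm_1_minus_exp_ge:
  fixes a :: real
  shows "1/2 \<le> norm (1 + of_real (exp a) * cis (- a))"
proof -
  have n2: "(norm (1 + of_real (exp a) * cis (- a)))\<^sup>2 = 1 + 2 * exp a * cos a + (exp a)\<^sup>2"
  proof -
    have "(norm (1 + of_real (exp a) * cis (- a)))\<^sup>2 = (1 + exp a * cos a)\<^sup>2 + (exp a * sin a)\<^sup>2"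
      by (simp add: cmod_power2)
    also have "\<dots> = 1 + 2 * exp a * cos a + (exp a)\<^sup>2 * ((sin a)\<^sup>2 + (cos a)\<^sup>2)"
      unfolding power2_eq_square distrib_left distrib_right by (simp only: mult_1_left mult_1_right ac_simps)
    finally show ?thesis by simp
  qed
  have "1/4 \<le> 1 + 2 * exp a * cos a + (exp a)\<^sup>2"
  proof (cases "\<bar>a\<bar> \<le> pi / 2")
    case True
    then have "cos a \<ge> 0" by (intro cos_ge_zero) auto
    then show ?thesis by (smt (verit) exp_gt_zero mult_nonneg_nonneg zero_le_power2 divide_le_eq_1)
  next
    case False
    have 1: "2 * exp a * cos a \<ge> - (2 * exp a)"
      using mult_left_mono[of "-1" "cos a" "2 * exp a"] by simp
    have "\<bar>a\<bar> > 3/2" using False pi_gt3 by simp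
    then consider "a > 3/2" | "a < - (3/2)" by linarith
    then have "1/4 \<le> (1 - exp a)\<^sup>2"
    proof cases
      case 1
      then have "exp a \<ge> 2" using exp_ge_add_one_self[of a] by linarith
      then have "1\<^sup>2 \<le> (exp a - 1)\<^sup>2" by (intro power_mono) auto
      then show ?thesis by (simp add: power2_commute)
    next
      case 2
      have "exp (-a) \<ge> 2" using exp_ge_add_one_self[of "-a"] 2 by linarith
      then have "exp a \<le> 1/2" by (simp add: exp_minus field_simps)
      then have "(1/2)\<^sup>2 \<le> (1 - exp a)\<^sup>2" by (intro power_mono) auto
      then show ?thesis by (simp add: power2_eq_square)
    qed
    also have "(1 - exp a)\<^sup>2 = 1 + - (2 * exp a) + (exp a)\<^sup>2" by (simp add: power2_eq_square algebra_simps)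
    finally show ?thesis using 1 by linarith
  qed
  then have "(1/2)\<^sup>2 \<le> (norm (1 + of_real (exp a) * cis (- a)))\<^sup>2"
    unfolding n2 by (simp add: power2_eq_square)
  then show ?thesis by (rule power2_le_imp_le) simp
qed

text \<open>The modulus is independent of \<open>k\<close> because (-1 + i)^2 is purely imaginary:
  completing the square produces only a phase. The real part of the linear term is removed by an
  affine substitution, and the imaginary part leaves the characteristic function of the standard
  normal law.\<close>

lemma gaussian_integral:
  fixes k :: real
  shows "integrable lborel (\<lambda>u. exp (- of_real (2 * pi * u\<^sup>2) + of_real (k * u) * (-1 + \<i>)))"
    and "norm (LINT u|lborel. exp (- of_real (2 * pi * u\<^sup>2) + of_real (k * u) * (-1 + \<i>))) = 1 / sqrt 2"
proof -
  define g :: "real \<Rightarrow> complex" where "g v = std_normal_density v *\<^sub>R iexp (k / (2 * sqrt pi) * v)" for v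
  define h where "h u = exp (- of_real (2 * pi * u\<^sup>2) + of_real (k * u) * (-1 + \<i>))" for u :: real
  have g: "integrable lborel g"
    unfolding g_def
    by (rule Bochner_Integration.integrable_bound[OF integrable_normal_density[of 1 0]]) auto
  have char: "(LINT v|lborel. g v) = exp (- ((k / (2 * sqrt pi))\<^sup>2) / 2)"
  proof -
    have "char std_normal_distribution (k / (2 * sqrt pi)) = (LINT v|lborel. g v)"
      unfolding char_def g_def by (subst integral_density) auto
    then show ?thesis unfolding char_std_normal_distribution by (simp add: exp_of_real)
  qed
  define C where "C = complex_of_real (sqrt (2 * pi) * exp (k\<^sup>2 / (8 * pi))) * cis (- (k\<^sup>2 / (4 * pi)))"
  have eq: "h u = C * g (k / (2 * sqrt pi) + (2 * sqrt pi) * u)" for u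
  proof -
    define v where "v = k / (2 * sqrt pi) + (2 * sqrt pi) * u"
    define q where "q = sqrt pi"
    have q: "q > 0" "pi = q * q" by (simp_all add: q_def)
    have v2: "v\<^sup>2 = k\<^sup>2 / (4 * pi) + 2 * k * u + 4 * pi * u\<^sup>2"
      unfolding v_def q_def[symmetric] q(2) using q(1) by (simp add: power2_eq_square field_simps)
    have kv: "k / (2 * sqrt pi) * v = k\<^sup>2 / (4 * pi) + k * u"
      unfolding v_def q_def[symmetric] q(2) using q(1) by (simp add: power2_eq_square field_simps)
    have "C * g v = of_real (exp (k\<^sup>2 / (8 * pi)) * exp (- v\<^sup>2 / 2)) * (cis (- (k\<^sup>2 / (4 * pi))) * iexp (k / (2 * sqrt pi) * v))"
      unfolding C_def g_def std_normal_density_def scaleR_conv_of_real by simp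
    also have "exp (k\<^sup>2 / (8 * pi)) * exp (- v\<^sup>2 / 2) = exp (- (2 * pi * u\<^sup>2) - k * u)"
      unfolding exp_add[symmetric] v2 by (simp add: field_simps)
    also have "cis (- (k\<^sup>2 / (4 * pi))) * iexp (k / (2 * sqrt pi) * v) = cis (k * u)"
      unfolding kv cis_conv_exp[symmetric] cis_mult by simp
    also have "of_real (exp (- (2 * pi * u\<^sup>2) - k * u)) * cis (k * u) = h u"
      unfolding h_def cis_conv_exp exp_of_real[symmetric] exp_add[symmetric] by (simp add: algebra_simps)
    finally show ?thesis by (simp add: v_def)
  qed
  have p: "2 * sqrt pi \<noteq> 0" by simp
  show "integrable lborel h"
    unfolding eq by (intro integrable_mult_right lborel_integrable_real_affine[OF g p])
  have "(LINT v|lborel. g v) = \<bar>2 * sqrt pi\<bar> *\<^sub>R (LINT u|lborel. g (k / (2 * sqrt pi) + (2 * sqrt pi) * u))"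
    by (rule lborel_integral_real_affine[OF p])
  then have "(LINT u|lborel. g (k / (2 * sqrt pi) + (2 * sqrt pi) * u)) = of_real (exp (- ((k / (2 * sqrt pi))\<^sup>2) / 2) / (2 * sqrt pi))"
    unfolding char by (simp add: scaleR_conv_of_real field_simps)
  then have "(LINT u|lborel. h u) = C * of_real (exp (- ((k / (2 * sqrt pi))\<^sup>2) / 2) / (2 * sqrt pi))"
    unfolding eq using lborel_integrable_real_affine[OF g p] by simp
  also have "norm \<dots> = sqrt (2 * pi) * exp (k\<^sup>2 / (8 * pi)) * (exp (- ((k / (2 * sqrt pi))\<^sup>2) / 2) / (2 * sqrt pi))"
    unfolding C_def norm_mult norm_cis norm_of_real by simp
  also have "\<dots> = sqrt (2 * pi) / (2 * sqrt pi) * (exp (k\<^sup>2 / (8 * pi)) * exp (- ((k / (2 * sqrt pi))\<^sup>2) / 2))"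
    by simp
  also have "exp (k\<^sup>2 / (8 * pi)) * exp (- ((k / (2 * sqrt pi))\<^sup>2) / 2) = 1"
    unfolding exp_add[symmetric] by (simp add: power_divide power_mult_distrib)
  also have "sqrt (2 * pi) / (2 * sqrt pi) * 1 = 1 / sqrt 2"
    by (simp add: real_sqrt_mult field_simps)
  finally show "norm (LINT u|lborel. h u) = 1 / sqrt 2" .
qed

section \<open>The phase on a line through the saddle point\<close>

text \<open>The line of integration misses the saddle point \<open>a - \<i> b\<close> by a horizontal shift \<open>d\<close>, which keeps the crossing point \<open>a + b + d\<close> with the real axis away from the poles.\<close>

locale saddle_line =
  fixes a b d :: real
  assumes a: "0 \<le> a" "a \<le> b" and b: "2 \<le> b" and d: "\<bar>d\<bar> \<le> 1/2"
    and half_integer: "a + b + d - 1/2 \<in> \<int>"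
begin

definition saddle :: complex where "saddle = Complex a (- b)"
definition s :: complex where "s = 2 * of_real pi * \<i> * saddle\<^sup>2"
definition p :: complex where "p = saddle + of_real d"
definition line :: "real \<Rightarrow> complex" where "line u = p + of_real u * om"

lemma Re_p: "Re p = a + d" and Im_p: "Im p = - b"
  by (simp_all add: p_def saddle_def)

lemma Re_line: "Re (line u) = a + d + u * (sqrt 2 / 2)" and Im_line: "Im (line u) = - b + u * (sqrt 2 / 2)"
  by (simp_all add: line_def Re_p Im_p cos_45 sin_45)

lemma line_eq_aux_line: "line u = aux_line (a + b + d) (sqrt 2 * b - u)"
  by (simp add: complex_eq_iff Re_line Im_line Re_aux_line Im_aux_line field_simps)

lemma crossing: "0 < a + b + d" "a + b + d \<notin> \<int>"
proof -
  show "0 < a + b + d" using a b d by linarith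
  show "a + b + d \<notin> \<int>"
  proof
    assume "a + b + d \<in> \<int>"
    from Ints_diff[OF this half_integer] have "(1/2::real) \<in> \<int>" by simp
    then show False by (auto elim!: Ints_cases)
  qed
qed

lemma line_not_nonpos: "line u \<notin> \<real>\<^sub>\<le>\<^sub>0"
  unfolding line_eq_aux_line using crossing(1) by (rule aux_line_not_nonpos)

lemma line_neq_0: "line u \<noteq> 0"
  using line_not_nonpos[of u] by auto

lemma norm_line_ge: "b / 2 \<le> norm (line u)"
proof -
  \<comment> \<open>The distance from the origin is (a + b + d) sqrt 2 / 2 with a + b + d >= b -
    1/2; the rational bound 7/5 suffices because b >= 2.\<close>
  have "7/5 \<le> sqrt 2" by (rule real_le_rsqrt) (simp add: power2_eq_square)
  then have "(b - 1/2) * (7/5) \<le> (a + b + d) * sqrt 2" using a b d by (intro mult_mono) auto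
  moreover have "b \<le> (b - 1/2) * (7/5)" using b by simp
  ultimately have "b \<le> (a + b + d) * sqrt 2" by (rule order_trans[rotated])
  then have "b / 2 \<le> (a + b + d) * (sqrt 2 / 2)" by simp
  also have "\<dots> \<le> norm (line u)" unfolding line_eq_aux_line by (rule norm_aux_line_ge)
  finally show ?thesis .
qed

lemma norm_saddle_le: "norm saddle \<le> sqrt 2 * b"
proof -
  have "a\<^sup>2 \<le> b\<^sup>2" using a by (intro power_mono) auto
  then have "sqrt (a\<^sup>2 + b\<^sup>2) \<le> sqrt (2 * b\<^sup>2)" by (intro real_sqrt_le_mono) auto
  then show ?thesis using b by (simp add: saddle_def cmod_def real_sqrt_mult)
qed

lemma norm_saddle_double_le: "2 * norm saddle + 1/2 \<le> 4 * b"
proof -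
  have "sqrt 2 \<le> 3/2" by (rule real_le_lsqrt) (auto simp: power2_eq_square)
  then have "sqrt 2 * b \<le> 3/2 * b" using b by (intro mult_right_mono) auto
  then show ?thesis using norm_saddle_le b by linarith
qed

text \<open>Up to a bounded term the derivative of the phase along the line is \<open>-2 pi u (1 + p / line u)\<close>, so this bound gives Gaussian decay on the whole line, not only near the saddle point.\<close>

lemma Re_p_div_line_ge: "- (1/2) \<le> Re (p / line u)"
proof -
  define A where "A = a + d"
  define k where "k = u * (sqrt 2 / 2)"
  have nz: "(A + k)\<^sup>2 + (- b + k)\<^sup>2 > 0"
    using line_neq_0[of u] by (auto simp: complex_eq_iff Re_line Im_line A_def k_def sum_power2_gt_zero_iff)
  have "Re (p / line u) = (A * (A + k) + (- b) * (- b + k)) / ((A + k)\<^sup>2 + (- b + k)\<^sup>2)"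
    by (simp add: Re_divide Re_p Im_p Re_line Im_line A_def k_def)
  moreover have "0 \<le> A * (A + k) + (- b) * (- b + k) + ((A + k)\<^sup>2 + (- b + k)\<^sup>2) / 2"
  proof -
    \<comment> \<open>Only the shift \<open>d\<close> can make \<open>A\<close> negative, and |d| <=
      1/2 <= b / 4.\<close>
    have Ab: "A * b \<ge> - (b\<^sup>2) / 4"
    proof -
      have "A \<ge> - (b / 4)" using a b d by (simp add: A_def abs_le_iff)
      then have "A * b \<ge> - (b / 4) * b" using b by (intro mult_right_mono) auto
      then show ?thesis by (simp add: power2_eq_square)
    qed
    have "0 \<le> b\<^sup>2 / 2 + 2 * (A * b)" using Ab by linarith
    then have "0 \<le> (k + (A - b))\<^sup>2 + A\<^sup>2 / 2 + (b\<^sup>2 / 2 + 2 * (A * b))" by simp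
    also have "\<dots> = A * (A + k) + (- b) * (- b + k) + ((A + k)\<^sup>2 + (- b + k)\<^sup>2) / 2"
      by (simp add: power2_eq_square field_simps)
    finally show ?thesis .
  qed
  ultimately show ?thesis using nz by (simp add: field_simps)
qed

text \<open>Relative to the saddle point, x^2 - x0^2 splits into
  \<open>of_real u * om * (line u + p)\<close> and a part caused by the shift \<open>d\<close>. In
  the former, om^2 = i turns 2 pi i into -2 pi; the latter is the bounded perturbation.\<close>

lemma phase_line_deriv:
  "((\<lambda>u. Re (phase s (line u))) has_real_derivative
     (- (2 * pi * u) * (1 + Re (p / line u)) + Re (om * (2 * of_real pi * \<i> * of_real d * (2 * saddle + of_real d) / line u)))) (at u)"
proof -
  have "((\<lambda>z. phase s (p + z * om)) has_field_derivative
      (2 * of_real pi * \<i> * ((line u)\<^sup>2 - saddle\<^sup>2) / line u) * om) (at (of_real u))"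
  proof (rule DERIV_chain'[where f = "\<lambda>z. p + z * om" and g = "phase s"])
    show "((\<lambda>z. p + z * om) has_field_derivative om) (at (of_real u))"
      by (auto intro!: derivative_eq_intros)
    show "(phase s has_field_derivative (2 * of_real pi * \<i> * ((line u)\<^sup>2 - saddle\<^sup>2) / line u)) (at (p + of_real u * om))"
      unfolding line_def[symmetric] by (rule phase_deriv[OF line_not_nonpos s_def])
  qed
  from has_vector_derivative_real_field[OF this]
  have "((\<lambda>u. phase s (line u)) has_vector_derivative (2 * of_real pi * \<i> * ((line u)\<^sup>2 - saddle\<^sup>2) / line u) * om) (at u)"
    by (simp add: line_def)
  then have 1: "((\<lambda>u. Re (phase s (line u))) has_real_derivative Re ((2 * of_real pi * \<i> * ((line u)\<^sup>2 - saddle\<^sup>2) / line u) * om)) (at u)"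
    unfolding has_real_derivative_iff_has_vector_derivative
    by (rule bounded_linear.has_vector_derivative[OF bounded_linear_Re])
  have "(line u)\<^sup>2 - saddle\<^sup>2 = of_real u * om * (line u + p) + of_real d * (2 * saddle + of_real d)"
    by (simp add: line_def p_def power2_eq_square algebra_simps)
  then have "(2 * of_real pi * \<i> * ((line u)\<^sup>2 - saddle\<^sup>2) / line u) * om
     = 2 * of_real pi * \<i> * om\<^sup>2 * of_real u * ((line u + p) / line u)
      + om * (2 * of_real pi * \<i> * of_real d * (2 * saddle + of_real d) / line u)"
    by (simp add: power2_eq_square add_divide_distrib[symmetric] algebra_simps)
  also have "(line u + p) / line u = 1 + p / line u"
    using line_neq_0[of u] by (simp add: add_divide_distrib)
  also have "2 * of_real pi * \<i> * om\<^sup>2 * of_real u * (1 + p / line u) = of_real (- (2 * pi * u)) * (1 + p / line u)"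
    unfolding om_power2 by (simp add: algebra_simps)
  finally have "Re ((2 * of_real pi * \<i> * ((line u)\<^sup>2 - saddle\<^sup>2) / line u) * om)
     = - (2 * pi * u) * (1 + Re (p / line u)) + Re (om * (2 * of_real pi * \<i> * of_real d * (2 * saddle + of_real d) / line u))"
    by (simp only: Re_complex_of_real Im_complex_of_real plus_complex.sel times_complex.sel one_complex.sel)
  with 1 show ?thesis by simp
qed

lemma phase_line_perturbation:
  "\<bar>Re (om * (2 * of_real pi * \<i> * of_real d * (2 * saddle + of_real d) / line u))\<bar> \<le> 8 * pi"
proof -
  have n: "norm (2 * saddle + of_real d) \<le> 4 * b"
    using norm_triangle_ineq[of "2 * saddle" "of_real d"] norm_saddle_double_le d by simp
  have "norm (om * (2 * of_real pi * \<i> * of_real d * (2 * saddle + of_real d) / line u))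
      = 2 * pi * \<bar>d\<bar> * norm (2 * saddle + of_real d) / norm (line u)"
    by (simp add: norm_mult norm_divide)
  also have "\<dots> \<le> 2 * pi * (1/2) * (4 * b) / (b / 2)"
    using d b n norm_line_ge[of u] by (intro frac_le mult_mono) auto
  also have "\<dots> = 8 * pi" using b by simp
  finally show ?thesis using abs_Re_le_cmod order_trans by blast
qed

text \<open>Integration of the derivative outwards from u = 0: the factor
  \<open>1 + Re (p / line u)\<close> is at least 1/2, so for u >= 0 the slope is at most -pi u + 8
  pi, and symmetrically for u <= 0.\<close>

lemma Re_phase_line_le: "Re (phase s (line u) - phase s p) \<le> - (pi * u\<^sup>2 / 2) + 8 * pi * \<bar>u\<bar>"
proof -
  let ?e = "\<lambda>u. Re (om * (2 * of_real pi * \<i> * of_real d * (2 * saddle + of_real d) / line u))"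
  have q: "pi * u / 2 * 2 \<le> 2 * pi * u * (1 + Re (p / line u))" if "u \<ge> 0" for u
  proof -
    have "(2 * pi * u) * (1/2) \<le> (2 * pi * u) * (1 + Re (p / line u))"
      using Re_p_div_line_ge[of u] that by (intro mult_left_mono) auto
    then show ?thesis by simp
  qed
  have q': "pi * u / 2 * 2 \<ge> 2 * pi * u * (1 + Re (p / line u))" if "u \<le> 0" for u
  proof -
    have "(2 * pi * u) * (1/2) \<ge> (2 * pi * u) * (1 + Re (p / line u))"
      using Re_p_div_line_ge[of u] that by (intro mult_left_mono_neg) (auto simp: mult_nonneg_nonpos)
    then show ?thesis by simp
  qed
  have line0: "line 0 = p" by (simp add: line_def)
  define f where "f u = Re (phase s (line u))" for u
  define f' where "f' u = - (2 * pi * u) * (1 + Re (p / line u)) + ?e u" for u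
  have f_deriv: "(f has_real_derivative f' u) (at u)" for u
    unfolding f_def[abs_def] f'_def by (rule phase_line_deriv)
  show ?thesis
  proof (cases "u \<ge> 0")
    case True
    have "f u + pi * u\<^sup>2 / 2 - 8 * pi * u \<le> f 0 + pi * 0\<^sup>2 / 2 - 8 * pi * 0"
    proof (rule DERIV_nonpos_imp_nonincreasing[OF True])
      fix t assume t: "0 \<le> t" "t \<le> u"
      have "((\<lambda>u. f u + pi * u\<^sup>2 / 2 - 8 * pi * u) has_real_derivative
         f' t + pi * t - 8 * pi) (at t)"
        by (auto intro!: derivative_eq_intros f_deriv)
      moreover have "f' t + pi * t - 8 * pi \<le> 0"
        using q[OF t(1)] phase_line_perturbation[of t] unfolding f'_def abs_le_iff minus_mult_left[symmetric] by linarith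
      ultimately show "\<exists>y. ((\<lambda>u. f u + pi * u\<^sup>2 / 2 - 8 * pi * u) has_real_derivative y) (at t) \<and> y \<le> 0"
        by blast
    qed
    then show ?thesis using True by (simp add: f_def line0)
  next
    case False
    then have u: "u \<le> 0" by simp
    have "f u + pi * u\<^sup>2 / 2 + 8 * pi * u \<le> f 0 + pi * 0\<^sup>2 / 2 + 8 * pi * 0"
    proof (rule DERIV_nonneg_imp_nondecreasing[OF u])
      fix t assume t: "u \<le> t" "t \<le> 0"
      have "((\<lambda>u. f u + pi * u\<^sup>2 / 2 + 8 * pi * u) has_real_derivative
         f' t + pi * t + 8 * pi) (at t)"
        by (auto intro!: derivative_eq_intros f_deriv)
      moreover have "0 \<le> f' t + pi * t + 8 * pi"
        using q'[OF t(2)] phase_line_perturbation[of t] unfolding f'_def abs_le_iff minus_mult_left[symmetric] by linarith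
      ultimately show "\<exists>y. ((\<lambda>u. f u + pi * u\<^sup>2 / 2 + 8 * pi * u) has_real_derivative y) (at t) \<and> 0 \<le> y"
        by blast
    qed
    then show ?thesis using False by (simp add: f_def line0)
  qed
qed

text \<open>The derivative 2 pi i (x^2 - x0^2) / x differs from its linearisation 4 pi i (x - x0) by
  exactly -2 pi i (x - x0)^2 / x. This is \<open>E'\<close>, with x - x0 written as
  \<open>z * om + of_real d\<close>; the bound b/2 <= |x| supplies the factor 1/b.\<close>

lemma phase_line_taylor:
  "norm (phase s (line u) - phase s p - (- of_real (2 * pi * u\<^sup>2) + 4 * of_real pi * \<i> * of_real d * of_real u * om))
     \<le> 4 * pi / b * (\<bar>u\<bar> + 1)\<^sup>2 * \<bar>u\<bar>"
proof -
  define E where "E z = phase s (p + z * om) - (2 * of_real pi * \<i> * (z * om)\<^sup>2 + 4 * of_real pi * \<i> * of_real d * (z * om))" for z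
  define E' where "E' z = - (2 * of_real pi * \<i> * (z * om + of_real d)\<^sup>2 / (p + z * om)) * om" for z
  have seg: "\<exists>t. z = of_real t \<and> \<bar>t\<bar> \<le> \<bar>u\<bar>" if z: "z \<in> closed_segment 0 (of_real u)" for z :: complex
  proof -
    from z obtain x where x: "0 \<le> x" "x \<le> 1" "z = of_real (x * u)"
      by (auto simp: closed_segment_def scaleR_conv_of_real)
    then have "\<bar>x * u\<bar> \<le> 1 * \<bar>u\<bar>" unfolding abs_mult by (intro mult_right_mono) auto
    then show ?thesis using x by (intro exI[of _ "x * u"]) auto
  qed
  have "norm (E (of_real u) - E 0) \<le> 4 * pi / b * (\<bar>u\<bar> + 1)\<^sup>2 * norm (of_real u - 0 :: complex)"
  proof (rule field_differentiable_bound[where S = "closed_segment 0 (of_real u)" and f' = E'])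
    fix z :: complex assume z: "z \<in> closed_segment 0 (of_real u)"
    from seg[OF z] obtain t where t: "z = of_real t" "\<bar>t\<bar> \<le> \<bar>u\<bar>" by blast
    have l: "p + z * om = line t" by (simp add: line_def t)
    have nz: "line t \<noteq> 0" by (rule line_neq_0)
    have ln: "line t - z * om - of_real d = saddle" unfolding l[symmetric] p_def by simp
    have "((\<lambda>z. phase s (p + z * om)) has_field_derivative
      (2 * of_real pi * \<i> * ((line t)\<^sup>2 - saddle\<^sup>2) / line t) * om) (at z within closed_segment 0 (of_real u))"
    proof (rule DERIV_chain'[where f = "\<lambda>z. p + z * om" and g = "phase s"])
      show "((\<lambda>z. p + z * om) has_field_derivative om) (at z within closed_segment 0 (of_real u))"
        by (auto intro!: derivative_eq_intros)
      show "(phase s has_field_derivative (2 * of_real pi * \<i> * ((line t)\<^sup>2 - saddle\<^sup>2) / line t)) (at (p + z * om))"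
        unfolding l by (rule phase_deriv[OF line_not_nonpos s_def])
    qed
    then have "(E has_field_derivative (2 * of_real pi * \<i> * ((line t)\<^sup>2 - saddle\<^sup>2) / line t) * om
       - (2 * of_real pi * \<i> * (2 * z * om\<^sup>2) + 4 * of_real pi * \<i> * of_real d * om)) (at z within closed_segment 0 (of_real u))"
      unfolding E_def[abs_def] by (auto intro!: derivative_eq_intros simp: power2_eq_square)
    also have "(2 * of_real pi * \<i> * ((line t)\<^sup>2 - saddle\<^sup>2) / line t) * om
       - (2 * of_real pi * \<i> * (2 * z * om\<^sup>2) + 4 * of_real pi * \<i> * of_real d * om)
       = 2 * of_real pi * \<i> * om * (((line t)\<^sup>2 - saddle\<^sup>2 - 2 * z * om * line t - 2 * of_real d * line t) / line t)"
      using nz by (simp add: field_simps power2_eq_square)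
    also have "(line t)\<^sup>2 - saddle\<^sup>2 - 2 * z * om * line t - 2 * of_real d * line t = - ((z * om + of_real d)\<^sup>2)"
      unfolding ln[symmetric] by (simp add: power2_eq_square algebra_simps)
    also have "2 * of_real pi * \<i> * om * (- ((z * om + of_real d)\<^sup>2) / line t) = E' z"
      unfolding E'_def l by simp
    finally show "(E has_field_derivative E' z) (at z within closed_segment 0 (of_real u))" .
    have "norm (z * om + of_real d) \<le> \<bar>u\<bar> + 1"
      using norm_triangle_ineq[of "z * om" "of_real d"] t d by (simp add: norm_mult)
    then have "norm (z * om + of_real d) ^ 2 \<le> (\<bar>u\<bar> + 1)\<^sup>2" by (intro power_mono) auto
    then have "2 * pi * norm (z * om + of_real d) ^ 2 / norm (line t) \<le> 2 * pi * (\<bar>u\<bar> + 1)\<^sup>2 / (b / 2)"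
      using norm_line_ge[of t] b by (intro frac_le mult_mono) auto
    then show "norm (E' z) \<le> 4 * pi / b * (\<bar>u\<bar> + 1)\<^sup>2"
      unfolding E'_def l by (simp add: norm_mult norm_divide norm_power)
  qed auto
  also have "E (of_real u) - E 0 = phase s (line u) - phase s p - (- of_real (2 * pi * u\<^sup>2) + 4 * of_real pi * \<i> * of_real d * of_real u * om)"
    unfolding E_def line_def power_mult_distrib om_power2 by (simp add: algebra_simps)
  finally show ?thesis by simp
qed

text \<open>The exponential pulled out dominates below the real axis, where the saddle point
  lies.\<close>

lemma aux_denom_line: "aux_denom (line u) = exp (of_real pi * \<i> * line u) * (1 - exp (- (2 * of_real pi * \<i> * line u)))"
  by (simp add: aux_denom_def algebra_simps exp_add[symmetric])

lemma norm_exp_line: "norm (exp (- (2 * of_real pi * \<i> * line u))) = exp (2 * pi * (- b + u * (sqrt 2 / 2)))"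
  by (simp add: norm_exp_eq_Re Im_line)

text \<open>At a half-integer crossing the real part is m + 1/2 plus the imaginary part, so the
  exponential is - exp(A - i A) with A = 2 pi Im x.\<close>

lemma exp_line_gap: "1/2 \<le> norm (1 - exp (- (2 * of_real pi * \<i> * line u)))"
proof -
  define A where "A = 2 * pi * (- b + u * (sqrt 2 / 2))"
  obtain m where m: "a + b + d - 1/2 = of_int m" using half_integer by (auto elim: Ints_cases)
  have Re: "Re (line u) = of_int m + 1/2 + (- b + u * (sqrt 2 / 2))"
    unfolding Re_line m[symmetric] by simp
  have "exp (- (2 * of_real pi * \<i> * line u)) = of_real (exp A) * cis (- (2 * pi * Re (line u)))"
    by (simp add: exp_eq_polar Im_line A_def)
  also have "- (2 * pi * Re (line u)) = - A + (- pi) + 2 * pi * of_int (- m)"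
    unfolding Re A_def by (simp add: algebra_simps)
  also have "cis (- A + (- pi) + 2 * pi * of_int (- m)) = - cis (- A)"
    unfolding cis_mult[symmetric] cis_multiple_2pi[OF Ints_of_int] by (simp add: cis.code complex_eq_iff)
  finally have "exp (- (2 * of_real pi * \<i> * line u)) = - (of_real (exp A) * cis (- A))" by simp
  then show ?thesis using norm_1_minus_exp_ge[of A] by simp
qed

end

section \<open>Comparison of the shifted integral with a Gaussian\<close>

context saddle_line
begin

text \<open>The integrand along the line divided by the constant exp(phase s p - pi i p); see
  \<open>aux_integrand_line\<close>.\<close>

definition peak :: "real \<Rightarrow> complex" where
  "peak u = exp (phase s (line u) - phase s p - of_real pi * \<i> * (of_real u * om)) /
     (1 - exp (- (2 * of_real pi * \<i> * line u)))"

text \<open>The model for \<open>peak\<close>: the phase is cut off after its quadratic term and the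
  second factor of the denominator is replaced by 1. The linear coefficient joins 4 pi i d om from
  the shift with -pi i om from the denominator, using i om = (sqrt 2 / 2) (-1 + i).\<close>

definition gauss :: "real \<Rightarrow> complex" where
  "gauss u = exp (- of_real (2 * pi * u\<^sup>2) + of_real (pi * (4 * d - 1) * (sqrt 2 / 2) * u) * (-1 + \<i>))"

text \<open>Two errors of order 1/b: the Taylor remainder of the phase, and the factor
  \<open>1 - q\<close>, whose \<open>q\<close> carries exp(-2 pi b) <= 1/b. The constant 18 bounds 2
  + 4 pi, and 72 pi^2 comes from completing the square in 12 pi |u|.\<close>

lemma norm_peak_minus_gauss: "norm (peak u - gauss u) \<le> 18 * exp (72 * pi\<^sup>2) / b * exp (- u\<^sup>2)"
proof -
  define A where "A = phase s (line u) - phase s p - of_real pi * \<i> * (of_real u * om)"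
  define k where "k = pi * (4 * d - 1) * (sqrt 2 / 2)"
  define B where "B = - of_real (2 * pi * u\<^sup>2) + of_real (k * u) * (-1 + \<i>)"
  define q where "q = exp (- (2 * of_real pi * \<i> * line u))"
  \<comment> \<open>A common bound for both real exponents: 8 pi from
    \<open>Re_phase_line_le\<close> and pi from the factor exp(-pi i u om).\<close>
  define W where "W = - (pi * u\<^sup>2 / 2) + 9 * pi * \<bar>u\<bar>"
  have s2: "sqrt 2 / 2 \<le> (1::real)" "0 \<le> sqrt 2 / (2::real)" by (simp_all add: sqrt2_less_2 less_imp_le)
  have us: "u * (sqrt 2 / 2) \<le> \<bar>u\<bar>"
  proof -
    have "u * (sqrt 2 / 2) \<le> \<bar>u\<bar> * (sqrt 2 / 2)" using s2 by (intro mult_right_mono) auto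
    also have "\<dots> \<le> \<bar>u\<bar> * 1" using s2 by (intro mult_left_mono) auto
    finally show ?thesis by simp
  qed
  have "\<i> * om = of_real (sqrt 2 / 2) * (-1 + \<i>)" by (simp add: complex_eq_iff cos_45 sin_45)
  then have B: "B = - of_real (2 * pi * u\<^sup>2) + 4 * of_real pi * \<i> * of_real d * of_real u * om - of_real pi * \<i> * (of_real u * om)"
  proof -
    have "of_real (k * u) * (-1 + \<i>) = of_real (pi * (4 * d - 1) * u) * (of_real (sqrt 2 / 2) * (-1 + \<i>))"
      by (simp add: k_def)
    also have "\<dots> = of_real (pi * (4 * d - 1) * u) * (\<i> * om)"
      unfolding \<open>\<i> * om = _\<close> ..
    finally show ?thesis by (simp add: B_def algebra_simps)
  qed
  have AB: "norm (A - B) \<le> 4 * pi / b * ((\<bar>u\<bar> + 1)\<^sup>2 * \<bar>u\<bar>)"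
    using phase_line_taylor[of u] unfolding A_def B by (simp add: algebra_simps)
  have ReA: "Re A \<le> W"
  proof -
    have "Re A = Re (phase s (line u) - phase s p) + pi * (u * (sqrt 2 / 2))"
      by (simp add: A_def sin_45)
    also have "\<dots> \<le> (- (pi * u\<^sup>2 / 2) + 8 * pi * \<bar>u\<bar>) + pi * \<bar>u\<bar>"
      using us by (intro add_mono Re_phase_line_le mult_left_mono) auto
    finally show ?thesis by (simp add: W_def)
  qed
  have ReB: "Re B \<le> W"
  proof -
    have "\<bar>k\<bar> = pi * \<bar>4 * d - 1\<bar> * (sqrt 2 / 2)" by (simp add: k_def abs_mult)
    also have "\<dots> \<le> pi * 3 * 1" using d s2 by (intro mult_mono) (auto simp: abs_le_iff)
    finally have "\<bar>k\<bar> * \<bar>u\<bar> \<le> 3 * pi * \<bar>u\<bar>" by (intro mult_right_mono) auto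
    moreover have "- (k * u) \<le> \<bar>k\<bar> * \<bar>u\<bar>" using abs_ge_minus_self[of "k * u"] by (simp add: abs_mult)
    moreover have "Re B = - (2 * pi * u\<^sup>2) - k * u" by (simp add: B_def)
    moreover have "pi * u\<^sup>2 / 2 \<le> 2 * pi * u\<^sup>2" "3 * pi * \<bar>u\<bar> \<le> 9 * pi * \<bar>u\<bar>" by auto
    ultimately show ?thesis unfolding W_def by linarith
  qed
  have e1: "norm (exp A - exp B) \<le> 4 * pi / b * exp (W + 3 * pi * \<bar>u\<bar>)"
  proof -
    have "(\<bar>u\<bar> + 1)\<^sup>2 * \<bar>u\<bar> \<le> exp \<bar>u\<bar> ^ 2 * exp \<bar>u\<bar>"
    proof (intro mult_mono power_mono)
      show "\<bar>u\<bar> + 1 \<le> exp \<bar>u\<bar>" using exp_ge_add_one_self[of "\<bar>u\<bar>"] by linarith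
      then show "\<bar>u\<bar> \<le> exp \<bar>u\<bar>" by linarith
    qed auto
    also have "\<dots> = exp (3 * \<bar>u\<bar>)" by (simp add: exp_of_nat_mult[symmetric] exp_add[symmetric] power2_eq_square)
    also have "\<dots> \<le> exp (3 * pi * \<bar>u\<bar>)" using mult_right_mono[of 1 pi "\<bar>u\<bar>"] pi_gt3 by simp
    finally have e: "(\<bar>u\<bar> + 1)\<^sup>2 * \<bar>u\<bar> \<le> exp (3 * pi * \<bar>u\<bar>)" .
    have "norm (exp A - exp B) \<le> exp W * norm (A - B)" by (rule norm_exp_diff_le[OF ReA ReB])
    also have "\<dots> \<le> exp W * (4 * pi / b * ((\<bar>u\<bar> + 1)\<^sup>2 * \<bar>u\<bar>))" using AB by (intro mult_left_mono) auto
    also have "\<dots> \<le> exp W * (4 * pi / b * exp (3 * pi * \<bar>u\<bar>))" using e b by (intro mult_left_mono) auto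
    finally show ?thesis by (simp add: exp_add mult_ac)
  qed
  have e2: "norm (peak u - exp A) \<le> 2 / b * exp (W + 3 * pi * \<bar>u\<bar>)"
  proof -
    have nq: "norm (1 - q) \<ge> 1/2" using exp_line_gap[of u] by (simp add: q_def)
    then have nz: "1 - q \<noteq> 0" by auto
    have "peak u - exp A = exp A * q / (1 - q)"
      using nz unfolding peak_def A_def[symmetric] q_def[symmetric] by (simp add: field_simps)
    then have "norm (peak u - exp A) = exp (Re A) * norm q / norm (1 - q)"
      by (simp add: norm_mult norm_divide norm_exp_eq_Re)
    also have "\<dots> \<le> exp W * norm q / (1/2)" using ReA nq by (intro frac_le mult_mono) auto
    also have "norm q = exp (- (2 * pi * b)) * exp (2 * pi * (u * (sqrt 2 / 2)))"
      unfolding q_def norm_exp_line exp_add[symmetric] by (simp add: algebra_simps)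
    also have "\<dots> \<le> 1 / b * exp (3 * pi * \<bar>u\<bar>)"
    proof (rule mult_mono)
      have "b \<le> 1 * b + 1" by simp
      also have "\<dots> \<le> 2 * pi * b + 1" using pi_gt3 b by (intro add_mono mult_right_mono) auto
      also have "\<dots> \<le> exp (2 * pi * b)" using exp_ge_add_one_self[of "2 * pi * b"] by linarith
      finally show "exp (- (2 * pi * b)) \<le> 1 / b" using b by (simp add: exp_minus field_simps)
      have "2 * pi * (u * (sqrt 2 / 2)) \<le> 2 * pi * \<bar>u\<bar>" using us by (intro mult_left_mono) auto
      also have "\<dots> \<le> 3 * pi * \<bar>u\<bar>" by (intro mult_right_mono) auto
      finally show "exp (2 * pi * (u * (sqrt 2 / 2))) \<le> exp (3 * pi * \<bar>u\<bar>)" by simp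
    qed (use b in auto)
    finally show ?thesis by (simp add: exp_add mult_left_mono mult_ac)
  qed
  have g: "gauss u = exp B" by (simp add: gauss_def B_def k_def)
  have "norm (peak u - gauss u) \<le> norm (peak u - exp A) + norm (exp A - exp B)"
    unfolding g using norm_triangle_ineq[of "peak u - exp A" "exp A - exp B"] by simp
  also have "\<dots> \<le> 2 / b * exp (W + 3 * pi * \<bar>u\<bar>) + 4 * pi / b * exp (W + 3 * pi * \<bar>u\<bar>)"
    by (intro add_mono e1 e2)
  also have "\<dots> = (2 + 4 * pi) / b * exp (W + 3 * pi * \<bar>u\<bar>)" by (simp add: add_divide_distrib algebra_simps)
  also have "\<dots> \<le> 18 / b * exp (72 * pi\<^sup>2 - u\<^sup>2)"
  proof (rule mult_mono)
    show "(2 + 4 * pi) / b \<le> 18 / b" using pi_less_4 b by (intro divide_right_mono) auto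
    have "12 * pi * \<bar>u\<bar> \<le> u\<^sup>2 / 2 + 72 * pi\<^sup>2"
      using zero_le_power2[of "\<bar>u\<bar> - 12 * pi"] by (simp add: power2_eq_square algebra_simps)
    moreover have "3 * u\<^sup>2 \<le> pi * u\<^sup>2" using pi_gt3 by (intro mult_right_mono) auto
    ultimately show "exp (W + 3 * pi * \<bar>u\<bar>) \<le> exp (72 * pi\<^sup>2 - u\<^sup>2)"
      unfolding W_def exp_le_cancel_iff by linarith
  qed (use b in auto)
  finally show ?thesis by (simp add: exp_diff exp_minus field_simps)
qed

lemma aux_integrand_line: "aux_integrand s (line u) = exp (phase s p - of_real pi * \<i> * p) * peak u"
proof -
  have "aux_integrand s (line u) = exp (phase s (line u)) / (exp (of_real pi * \<i> * line u) * (1 - exp (- (2 * of_real pi * \<i> * line u))))"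
    unfolding aux_integrand_eq aux_denom_line phase_def exp_add ..
  also have "\<dots> = exp (phase s (line u) - of_real pi * \<i> * line u) / (1 - exp (- (2 * of_real pi * \<i> * line u)))"
    unfolding exp_diff by simp
  also have "phase s (line u) - of_real pi * \<i> * line u = (phase s p - of_real pi * \<i> * p) + (phase s (line u) - phase s p - of_real pi * \<i> * (of_real u * om))"
    by (simp add: line_def algebra_simps)
  finally show ?thesis unfolding exp_add peak_def by simp
qed

lemma integrable_peak: "integrable lborel peak"
proof -
  have "integrable lborel (\<lambda>u. aux_integrand s (aux_line (a + b + d) (sqrt 2 * b + (-1) * u)))"
    by (rule lborel_integrable_real_affine[OF integrable_aux_integrand_line[OF crossing]]) simp
  then have "integrable lborel (\<lambda>u. exp (phase s p - of_real pi * \<i> * p) * peak u)"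
    unfolding aux_integrand_line[symmetric] line_eq_aux_line by simp
  from integrable_mult_right[OF this, of "inverse (exp (phase s p - of_real pi * \<i> * p))"]
  show ?thesis unfolding mult.assoc[symmetric] left_inverse[OF exp_not_eq_zero] mult_1_left .
qed

lemma norm_riemann_aux: "norm (riemann_aux (a + b + d) s) = exp (Re (phase s p) - pi * b) * norm (LINT u|lborel. peak u)"
proof -
  have "riemann_aux (a + b + d) s = \<bar>-1\<bar> *\<^sub>R (LINT u|lborel. aux_integrand s (aux_line (a + b + d) (sqrt 2 * b + (-1) * u)) * (- om))"
    unfolding riemann_aux_def by (rule lborel_integral_real_affine) simp
  also have "\<dots> = (LINT u|lborel. exp (phase s p - of_real pi * \<i> * p) * peak u) * (- om)"
    unfolding aux_integrand_line[symmetric] line_eq_aux_line by simp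
  also have "(LINT u|lborel. exp (phase s p - of_real pi * \<i> * p) * peak u) = exp (phase s p - of_real pi * \<i> * p) * (LINT u|lborel. peak u)"
    by simp
  finally show ?thesis by (simp add: norm_mult norm_exp_eq_Re Im_p)
qed

text \<open>This is the bounded price of the horizontal shift. The derivative of the phase vanishes
  at the saddle point and stays below 4 pi on the segment, where |x| >= b, and the segment has
  length at most 1/2.\<close>

lemma norm_phase_p_minus_phase_saddle: "norm (phase s p - phase s saddle) \<le> 2 * pi"
proof -
  have "norm (phase s p - phase s saddle) \<le> 4 * pi * norm (p - saddle)"
  proof (rule field_differentiable_bound[where S = "closed_segment saddle p" and f' = "\<lambda>x. 2 * of_real pi * \<i> * (x\<^sup>2 - saddle\<^sup>2) / x"])
    fix x assume x: "x \<in> closed_segment saddle p"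
    then obtain t where t: "0 \<le> t" "t \<le> 1" "x = saddle + of_real (t * d)"
      by (auto simp: closed_segment_def p_def scaleR_conv_of_real algebra_simps)
    have Im: "Im x = - b" unfolding t(3) by (simp add: saddle_def)
    have td: "\<bar>t * d\<bar> \<le> 1/2"
      using mult_mono[of t 1 "\<bar>d\<bar>" "1/2"] t d by (simp add: abs_mult)
    show "(phase s has_field_derivative 2 * of_real pi * \<i> * (x\<^sup>2 - saddle\<^sup>2) / x) (at x within closed_segment saddle p)"
      using Im b by (intro phase_deriv s_def) (auto simp: complex_nonpos_Reals_iff)
    have "norm (2 * of_real pi * \<i> * (x\<^sup>2 - saddle\<^sup>2) / x) = 2 * pi * (\<bar>t * d\<bar> * norm (2 * saddle + of_real (t * d))) / norm x"
    proof -
      have "x\<^sup>2 - saddle\<^sup>2 = of_real (t * d) * (2 * saddle + of_real (t * d))"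
        unfolding t(3) by (simp add: power2_eq_square algebra_simps)
      then show ?thesis by (simp only: norm_mult norm_divide norm_of_real) (simp add: abs_mult)
    qed
    also have "\<dots> \<le> 2 * pi * (1/2 * (4 * b)) / b"
    proof (intro frac_le mult_mono td)
      show "norm (2 * saddle + of_real (t * d)) \<le> 4 * b"
        using norm_triangle_ineq[of "2 * saddle" "of_real (t * d)"] norm_saddle_double_le td
        by (simp only: norm_of_real norm_mult norm_numeral)
      show "b \<le> norm x" using abs_Im_le_cmod[of x] Im b by simp
    qed (use b in auto)
    also have "\<dots> = 4 * pi" using b by simp
    finally show "norm (2 * of_real pi * \<i> * (x\<^sup>2 - saddle\<^sup>2) / x) \<le> 4 * pi" .
  qed auto
  also have "\<dots> \<le> 4 * pi * (1/2)" using d by (intro mult_left_mono) (auto simp: p_def)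
  finally show ?thesis by simp
qed

text \<open>The constant 180 is ten times 18, so the integrals of \<open>peak\<close> and
  \<open>gauss\<close> differ by at most 1/10. The latter has modulus 1 / sqrt 2, so the former has
  modulus in [1/2, 1]. The upper bound simply drops exp(-pi b).\<close>

lemma norm_riemann_aux_bounds:
  assumes "180 * exp (72 * pi\<^sup>2) * (LINT u|lborel. exp (- u\<^sup>2)) \<le> b"
  shows "norm (riemann_aux (a + b + d) s) \<le> exp (Re (phase s saddle) + 2 * pi)"
    and "exp (Re (phase s saddle) - 2 * pi - pi * b) / 2 \<le> norm (riemann_aux (a + b + d) s)"
proof -
  define J where "J = norm (LINT u|lborel. peak u)"
  have gauss: "integrable lborel gauss" "norm (LINT u|lborel. gauss u) = 1 / sqrt 2"
    using gaussian_integral[of "pi * (4 * d - 1) * (sqrt 2 / 2)"] by (simp_all add: gauss_def[abs_def])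
  have "norm ((LINT u|lborel. peak u) - (LINT u|lborel. gauss u)) = norm (LINT u|lborel. peak u - gauss u)"
    using integrable_peak gauss by simp
  also have "\<dots> \<le> (LINT u|lborel. norm (peak u - gauss u))"
    by (rule integral_norm_bound)
  also have "\<dots> \<le> (LINT u|lborel. 18 * exp (72 * pi\<^sup>2) / b * exp (- u\<^sup>2))"
    by (intro integral_mono integrable_norm Bochner_Integration.integrable_diff integrable_peak gauss
         integrable_exp_minus_square norm_peak_minus_gauss)
  also have "\<dots> = 18 * exp (72 * pi\<^sup>2) * (LINT u|lborel. exp (- u\<^sup>2)) / b" by simp
  also have "\<dots> \<le> 1 / 10" using assms b by (simp add: field_simps)
  finally have "norm ((LINT u|lborel. peak u) - (LINT u|lborel. gauss u)) \<le> 1 / 10" .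
  then have "\<bar>J - 1 / sqrt 2\<bar> \<le> 1/10"
    using norm_triangle_ineq3[of "LINT u|lborel. peak u" "LINT u|lborel. gauss u"] gauss(2) by (simp add: J_def)
  moreover have "7/10 \<le> 1 / sqrt 2" "1 / sqrt 2 \<le> (3/4 :: real)"
  proof -
    have "7/5 \<le> sqrt 2" by (rule real_le_rsqrt) (simp add: power2_eq_square)
    moreover have "sqrt 2 \<le> 3/2" by (rule real_le_lsqrt) (auto simp: power2_eq_square)
    moreover have "1 / sqrt 2 = sqrt 2 / (2::real)" by (simp add: field_simps)
    ultimately show "7/10 \<le> 1 / sqrt 2" "1 / sqrt 2 \<le> (3/4 :: real)" by linarith+
  qed
  ultimately have J: "1/2 \<le> J" "J \<le> 1" by linarith+
  have "\<bar>Re (phase s p - phase s saddle)\<bar> \<le> 2 * pi"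
    using abs_Re_le_cmod norm_phase_p_minus_phase_saddle by (rule order_trans)
  then have ph: "Re (phase s p) \<le> Re (phase s saddle) + 2 * pi" "Re (phase s saddle) - 2 * pi \<le> Re (phase s p)"
    by (auto simp: abs_le_iff)
  have pb: "pi * b \<ge> 0" using b by simp
  have "norm (riemann_aux (a + b + d) s) = exp (Re (phase s p) - pi * b) * J"
    unfolding norm_riemann_aux J_def ..
  also have "\<dots> \<le> exp (Re (phase s saddle) + 2 * pi) * 1"
    using ph pb J by (intro mult_mono) auto
  finally show "norm (riemann_aux (a + b + d) s) \<le> exp (Re (phase s saddle) + 2 * pi)" by simp
  have "exp (Re (phase s saddle) - 2 * pi - pi * b) * (1/2) \<le> exp (Re (phase s p) - pi * b) * J"
    using ph J by (intro mult_mono) auto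
  then show "exp (Re (phase s saddle) - 2 * pi - pi * b) / 2 \<le> norm (riemann_aux (a + b + d) s)"
    unfolding norm_riemann_aux J_def by simp
qed

end

section \<open>Location of the zeros\<close>

lemma fourth_quadrant_polar:
  assumes "Re \<rho> > 0" "Im \<rho> < 0"
  obtains r \<delta> where "r > 0" "0 < \<delta>" "\<delta> < pi / 2" "cmod \<rho> = 2 * pi * r\<^sup>2"
    "\<rho> = of_real (2 * pi * r\<^sup>2) * cis (- (pi / 2) + \<delta>)"
proof -
  define r where "r = sqrt (cmod \<rho> / (2 * pi))"
  define \<theta> where "\<theta> = Arg \<rho>"
  have nz: "cmod \<rho> > 0" using assms by auto
  have r: "r > 0" "2 * pi * r\<^sup>2 = cmod \<rho>" using nz by (simp_all add: r_def)
  have \<rho>: "\<rho> = of_real (cmod \<rho>) * cis \<theta>"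
    using rcis_cmod_Arg[of \<rho>] by (simp add: rcis_def \<theta>_def)
  have cos: "cos \<theta> > 0" and sin: "sin \<theta> < 0"
    using assms nz arg_cong[OF \<rho>, of Re] arg_cong[OF \<rho>, of Im] by (auto simp: zero_less_mult_iff mult_less_0_iff)
  have b: "- pi < \<theta>" "\<theta> \<le> pi" using Arg_bounded[of \<rho>] by (simp_all add: \<theta>_def)
  have "\<theta> < 0" using sin sin_ge_zero[of \<theta>] b by linarith
  moreover have "- (pi / 2) < \<theta>"
  proof (rule ccontr)
    assume "\<not> - (pi / 2) < \<theta>"
    then have "cos (\<theta> + pi) \<ge> 0" using b by (intro cos_ge_zero) auto
    then show False using cos by simp
  qed
  ultimately show ?thesis
    using r \<rho> by (intro that[of r "\<theta> + pi / 2"]) (auto simp: algebra_simps)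
qed

text \<open>Multiplication by i adds pi/2 to the argument \<delta> - pi of x0^2, giving that of s.
  At the saddle point pi i x0^2 = s / 2, so the phase is -s log x0 + s / 2.\<close>

lemma Re_phase_saddle:
  assumes "r > 0" "0 < \<delta>" "\<delta> < pi / 2"
    and s: "s = of_real (2 * pi * r\<^sup>2) * cis (- (pi / 2) + \<delta>)"
    and x0: "x0 = of_real r * cis (\<delta> / 2 - pi / 2)"
  shows "s = 2 * of_real pi * \<i> * x0\<^sup>2"
    and "Re (phase s x0) = 2 * pi * r\<^sup>2 * saddle_height (ln r) \<delta>"
proof -
  have "2 * of_real pi * \<i> * x0\<^sup>2 = of_real (2 * pi * r\<^sup>2) * (cis (pi / 2) * (cis (\<delta> / 2 - pi / 2) * cis (\<delta> / 2 - pi / 2)))"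
    unfolding x0 by (simp add: power2_eq_square)
  also have "cis (pi / 2) * (cis (\<delta> / 2 - pi / 2) * cis (\<delta> / 2 - pi / 2)) = cis (- (pi / 2) + \<delta>)"
    unfolding cis_mult by (intro arg_cong[where f = cis]) (simp add: field_simps)
  finally show sx: "s = 2 * of_real pi * \<i> * x0\<^sup>2" using s by simp
  have "Ln x0 = of_real (ln r) + Ln (cis (\<delta> / 2 - pi / 2))"
    unfolding x0 using assms by (subst Ln_times_of_real) (auto simp: Ln_of_real)
  also have "Ln (cis (\<delta> / 2 - pi / 2)) = \<i> * of_real (\<delta> / 2 - pi / 2)"
    unfolding cis_conv_exp using assms by (subst Ln_exp) auto
  finally have L: "Ln x0 = of_real (ln r) + \<i> * of_real (\<delta> / 2 - pi / 2)" .
  have ph: "phase s x0 = s * (of_real (1/2 - ln r) - \<i> * of_real (\<delta> / 2 - pi / 2))"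
    unfolding phase_def L using sx by (simp add: algebra_simps)
  have s': "s = of_real (2 * pi * r\<^sup>2) * (of_real (sin \<delta>) - \<i> * of_real (cos \<delta>))"
  proof -
    have "cis (- (pi / 2) + \<delta>) = of_real (sin \<delta>) - \<i> * of_real (cos \<delta>)"
      by (simp add: complex_eq_iff cos_diff sin_diff)
    then show ?thesis using s by simp
  qed
  have "Re (phase s x0) = 2 * pi * r\<^sup>2 * (sin \<delta> * (1/2 - ln r) - cos \<delta> * (\<delta> / 2 - pi / 2))"
  proof -
    define A where "A = 2 * pi * r\<^sup>2"
    have "phase s x0 = of_real A * ((of_real (sin \<delta>) - \<i> * of_real (cos \<delta>)) * (of_real (1/2 - ln r) - \<i> * of_real (\<delta> / 2 - pi / 2)))"
      unfolding ph A_def by (subst s') (rule mult.assoc)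
    moreover define e where "e = \<delta> / 2 - pi / 2"
    ultimately show ?thesis unfolding A_def[symmetric] e_def[symmetric] by simp
  qed
  also have "sin \<delta> * (1/2 - ln r) - cos \<delta> * (\<delta> / 2 - pi / 2) = saddle_height (ln r) \<delta>"
    unfolding saddle_height_def by (simp add: field_simps)
  finally show "Re (phase s x0) = 2 * pi * r\<^sup>2 * saddle_height (ln r) \<delta>" .
qed

lemma riemann_aux_decomposition:
  assumes c: "0 < c" "c < 1"
  shows "\<exists>b0. \<forall>r \<delta> \<rho>. b0 \<le> r \<and> 0 < \<delta> \<and> \<delta> < pi / 2 \<and>
     \<rho> = of_real (2 * pi * r\<^sup>2) * cis (- (pi / 2) + \<delta>) \<longrightarrow>
     (\<exists>N I. 1 \<le> N \<and> real N \<le> 2 * r \<and>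
       riemann_aux c \<rho> = (\<Sum>n=1..N. exp (- \<rho> * of_real (ln (real n)))) + I \<and>
       norm I \<le> exp (2 * pi * r\<^sup>2 * saddle_height (ln r) \<delta> + 2 * pi) \<and>
       exp (2 * pi * r\<^sup>2 * saddle_height (ln r) \<delta> - 2 * pi - pi * r) / 2 \<le> norm I)"
proof -
  define K where "K = 180 * exp (72 * pi\<^sup>2) * (LINT u|lborel. exp (- u\<^sup>2))"
  show ?thesis
  \<comment> \<open>Since b >= r/2 below, these thresholds give b >= K and b >= 2.\<close>
  proof (rule exI[of _ "max (2 * K) 4"], rule allI, rule allI, rule allI, rule impI, elim conjE)
    fix r \<delta> :: real and \<rho> :: complex
    assume r: "max (2 * K) 4 \<le> r" and \<delta>: "0 < \<delta>" "\<delta> < pi / 2"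
      and \<rho>: "\<rho> = of_real (2 * pi * r\<^sup>2) * cis (- (pi / 2) + \<delta>)"
    have r': "r > 0" "2 * K \<le> r" "4 \<le> r" using r by auto
    \<comment> \<open>The saddle point is a - i b and the line through it meets the real axis at a +
      b; N + 1/2 is the midpoint of the unit interval containing a + b, hence |d| <= 1/2. The half
      angle is at most pi/4, hence a <= b.\<close>
    define a where "a = r * sin (\<delta> / 2)"
    define b where "b = r * cos (\<delta> / 2)"
    define N where "N = nat \<lfloor>a + b\<rfloor>"
    define d where "d = real N + 1/2 - (a + b)"
    have h: "0 \<le> \<delta> / 2" "\<delta> / 2 \<le> pi / 4" using \<delta> by auto
    have sc: "0 \<le> sin (\<delta> / 2)" "sin (\<delta> / 2) \<le> cos (\<delta> / 2)" "1/2 \<le> cos (\<delta> / 2)" "cos (\<delta> / 2) \<le> 1" "sin (\<delta> / 2) \<le> 1"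
    proof -
      show "0 \<le> sin (\<delta> / 2)" using h by (intro sin_ge_zero) auto
      have 1: "cos (pi / 4) \<le> cos (\<delta> / 2)" using h by (intro cos_monotone_0_pi_le) auto
      have "sin (\<delta> / 2) \<le> sin (pi / 4)" using h by (intro sin_monotone_2pi_le) auto
      then show "sin (\<delta> / 2) \<le> cos (\<delta> / 2)" using 1 by (simp add: sin_45 cos_45)
      have "1 \<le> sqrt (2::real)" by simp
      then show "1/2 \<le> cos (\<delta> / 2)" using 1 by (simp only: cos_45)
    qed auto
    have ab: "0 \<le> a" "a \<le> b" "r / 2 \<le> b" "b \<le> r" "a \<le> r"
      unfolding a_def b_def using sc r' mult_left_mono[OF sc(3), of r] by (auto simp: mult_left_le)
    have N: "real N \<le> a + b" "a + b < real N + 1"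
      using ab r' unfolding N_def by (auto simp: of_nat_floor)
    have N1: "1 \<le> N" "real N \<le> 2 * r" using N ab r' by (auto simp: Suc_le_eq intro: ccontr)
    have "real N = a + b + d - 1/2" by (simp add: d_def)
    then have "a + b + d - 1/2 \<in> \<int>" by (metis Ints_of_nat)
    moreover have "\<bar>d\<bar> \<le> 1/2" using N unfolding d_def by (intro abs_leI) linarith+
    moreover have "2 \<le> b" using ab r' by linarith
    ultimately interpret saddle_line a b d using ab by unfold_locales auto
    have x0: "saddle = of_real r * cis (\<delta> / 2 - pi / 2)"
      unfolding saddle_def by (simp add: complex_eq_iff a_def b_def cos_diff sin_diff)
    have s: "\<rho> = s" and ph: "Re (phase \<rho> saddle) = 2 * pi * r\<^sup>2 * saddle_height (ln r) \<delta>"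
      using Re_phase_saddle[OF r'(1) \<delta> \<rho> x0] by (simp_all add: s_def)
    have cN: "a + b + d = real N + 1/2" by (simp add: d_def)
    define I where "I = riemann_aux (real N + 1/2) \<rho>"
    have K: "K \<le> b" using r' ab by linarith
    note bounds = norm_riemann_aux_bounds[OF K[unfolded K_def], folded s, unfolded ph cN, folded I_def]
    have "exp (2 * pi * r\<^sup>2 * saddle_height (ln r) \<delta> - 2 * pi - pi * r) / 2
        \<le> exp (2 * pi * r\<^sup>2 * saddle_height (ln r) \<delta> - 2 * pi - pi * b) / 2"
      using ab by simp
    also note bounds(2)
    finally show "\<exists>N I. 1 \<le> N \<and> real N \<le> 2 * r \<and>
       riemann_aux c \<rho> = (\<Sum>n=1..N. exp (- \<rho> * of_real (ln (real n)))) + I \<and>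
       norm I \<le> exp (2 * pi * r\<^sup>2 * saddle_height (ln r) \<delta> + 2 * pi) \<and>
       exp (2 * pi * r\<^sup>2 * saddle_height (ln r) \<delta> - 2 * pi - pi * r) / 2 \<le> norm I"
      using N1 bounds(1) riemann_aux_shift[OF c N1(1), of \<rho>] unfolding I_def by blast
  qed
qed

text \<open>Needed to make Re \<rho> = 2 pi r^2 sin \<delta> large when n = 1 is to dominate. For a
  smaller sine the cosine part of the height is at least 3/8, while the sine part is at most ln r /
  r < 1/4, so the height would be positive.\<close>

lemma saddle_height_nonpos_sin:
  assumes "r \<ge> 2" "0 < \<delta>" "\<delta> < pi / 2" "saddle_height (ln r) \<delta> \<le> 0" "ln r / r < 1/4"
  shows "1 / r \<le> sin \<delta>"
proof (rule ccontr)
  assume "\<not> 1 / r \<le> sin \<delta>"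
  then have s: "sin \<delta> < 1 / r" by simp
  have s0: "sin \<delta> > 0" and c0: "cos \<delta> > 0" using assms by (auto intro!: sin_gt_zero cos_gt_zero_pi)
  have "1 / r \<le> 1/2" using assms by (simp add: field_simps)
  then have "(sin \<delta>)\<^sup>2 \<le> (1/2)\<^sup>2" using s s0 by (intro power_mono) auto
  then have "(1/2)\<^sup>2 \<le> (cos \<delta>)\<^sup>2" using sin_cos_squared_add[of \<delta>] by (simp add: power2_eq_square)
  then have c: "1/2 \<le> cos \<delta>" by (rule power2_le_imp_le) (use c0 in simp)
  have "3/4 \<le> (pi - \<delta>) / 2" using assms(3) pi_gt3 by simp
  then have "1/2 * (3/4) \<le> cos \<delta> * ((pi - \<delta>) / 2)" using c by (intro mult_mono) auto
  moreover have "sin \<delta> * (ln r - 1/2) \<le> sin \<delta> * ln r" using s0 by (intro mult_left_mono) auto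
  moreover have "sin \<delta> * ln r \<le> 1 / r * ln r" using s assms by (intro mult_right_mono) auto
  ultimately show False using assms(4,5) unfolding saddle_height_def by simp
qed

lemma zero_saddle_height_small:
  assumes c: "0 < c" "c < 1"
  shows "eventually (\<lambda>r. \<forall>\<rho> \<delta>. 0 < \<delta> \<longrightarrow> \<delta> < pi / 2 \<longrightarrow>
     \<rho> = of_real (2 * pi * r\<^sup>2) * cis (- (pi / 2) + \<delta>) \<longrightarrow> riemann_aux c \<rho> = 0 \<longrightarrow>
     \<bar>saddle_height (ln r) \<delta>\<bar> < 1 / r) at_top"
proof -
  obtain b0 where b0: "\<forall>r \<delta> \<rho>. b0 \<le> r \<and> 0 < \<delta> \<and> \<delta> < pi / 2 \<and>
     \<rho> = of_real (2 * pi * r\<^sup>2) * cis (- (pi / 2) + \<delta>) \<longrightarrow>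
     (\<exists>N I. 1 \<le> N \<and> real N \<le> 2 * r \<and>
       riemann_aux c \<rho> = (\<Sum>n=1..N. exp (- \<rho> * of_real (ln (real n)))) + I \<and>
       norm I \<le> exp (2 * pi * r\<^sup>2 * saddle_height (ln r) \<delta> + 2 * pi) \<and>
       exp (2 * pi * r\<^sup>2 * saddle_height (ln r) \<delta> - 2 * pi - pi * r) / 2 \<le> norm I)"
    using riemann_aux_decomposition[OF c] by (rule exE)
  \<comment> \<open>The first inequality serves h >= 1/r: at most 2r terms of modulus at most 1
    cannot cancel I. The next two serve h <= -1/r: I and the terms with n >= 2 are each below 1/4
    and cannot cancel 1.\<close>
  have "eventually (\<lambda>r::real. 2 * r < exp (pi * r - 2 * pi) / 2) at_top" by real_asymp
  moreover have "eventually (\<lambda>r::real. exp (- (2 * pi * r) + 2 * pi) < 1/4) at_top" by real_asymp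
  moreover have "eventually (\<lambda>r::real. 2 * r * exp (- (r * ln 2)) < 1/4) at_top" by real_asymp
  moreover have "eventually (\<lambda>r::real. ln r / r < 1/4) at_top" by real_asymp
  moreover note eventually_ge_at_top[of b0] eventually_ge_at_top[of "2::real"]
  ultimately show ?thesis
  proof eventually_elim
    case (elim r)
    show ?case
    proof (intro allI impI)
      fix \<rho> \<delta>
      assume \<delta>: "0 < \<delta>" "\<delta> < pi / 2" and \<rho>: "\<rho> = of_real (2 * pi * r\<^sup>2) * cis (- (pi / 2) + \<delta>)"
        and zero: "riemann_aux c \<rho> = 0"
      define h where "h = saddle_height (ln r) \<delta>"
      from b0[rule_format, OF conjI[OF elim(5) conjI[OF \<delta>(1) conjI[OF \<delta>(2) \<rho>]]]] zero obtain N I where N: "1 \<le> N" "real N \<le> 2 * r"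
        and sum: "0 = (\<Sum>n=1..N. exp (- \<rho> * of_real (ln (real n)))) + I"
        and up: "norm I \<le> exp (2 * pi * r\<^sup>2 * h + 2 * pi)"
        and lo: "exp (2 * pi * r\<^sup>2 * h - 2 * pi - pi * r) / 2 \<le> norm I"
        unfolding h_def by auto
      have rr: "2 * pi * r\<^sup>2 * (1 / r) = 2 * pi * r" using elim(6) by (simp add: power2_eq_square)
      have Re: "Re \<rho> = 2 * pi * r\<^sup>2 * sin \<delta>" unfolding \<rho> by (simp add: cos_diff)
      have s0: "sin \<delta> > 0" using \<delta> by (intro sin_gt_zero) auto
      have I: "norm I = norm (\<Sum>n=1..N. exp (- \<rho> * of_real (ln (real n))))"
        using sum by (metis add_eq_0_iff norm_minus_cancel)
      have nterm: "norm (exp (- \<rho> * of_real (ln (real n)))) = exp (- (Re \<rho> * ln (real n)))" for n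
        by (simp add: norm_exp_eq_Re)
      have "h < 1 / r"
      proof (rule ccontr)
        assume "\<not> h < 1 / r"
        then have "2 * pi * r \<le> 2 * pi * r\<^sup>2 * h" unfolding rr[symmetric] by (intro mult_left_mono) auto
        then have "exp (pi * r - 2 * pi) / 2 \<le> exp (2 * pi * r\<^sup>2 * h - 2 * pi - pi * r) / 2" by simp
        also note lo
        also note I
        also have "norm (\<Sum>n=1..N. exp (- \<rho> * of_real (ln (real n)))) \<le> (\<Sum>n=1..N. 1)"
        proof (rule sum_norm_le)
          fix n assume "n \<in> {1..N}"
          then show "norm (exp (- \<rho> * of_real (ln (real n)))) \<le> 1"
            unfolding nterm using s0 by (simp add: Re)
        qed
        also have "\<dots> \<le> 2 * r" using N by simp
        finally show False using elim(1) by simp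
      qed
      moreover have "- (1 / r) < h"
      proof (rule ccontr)
        assume "\<not> - (1 / r) < h"
        then have "2 * pi * r\<^sup>2 * h \<le> 2 * pi * r\<^sup>2 * (- (1 / r))" by (intro mult_left_mono) auto
        then have hr: "2 * pi * r\<^sup>2 * h \<le> - (2 * pi * r)" using rr by simp
        have "1 / r > 0" using elim(6) by simp
        then have h0: "h \<le> 0" using \<open>\<not> - (1 / r) < h\<close> by linarith
        have "norm I \<le> exp (- (2 * pi * r) + 2 * pi)" using hr by (intro order_trans[OF up]) simp
        then have I4: "norm I < 1/4" using elim(2) by simp
        have "1 / r \<le> sin \<delta>" using elim(4,6) \<delta> h0 by (intro saddle_height_nonpos_sin) (auto simp: h_def)
        then have "2 * pi * r \<le> Re \<rho>" unfolding Re rr[symmetric] by (intro mult_left_mono) auto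
        moreover have "1 * r \<le> 2 * pi * r" using pi_gt3 elim(6) by (intro mult_right_mono) auto
        ultimately have \<sigma>: "r \<le> Re \<rho>" by simp
        have "norm (\<Sum>n=2..N. exp (- \<rho> * of_real (ln (real n)))) \<le> (\<Sum>n=2..N. exp (- (r * ln 2)))"
        proof (rule sum_norm_le)
          fix n assume n: "n \<in> {2..N}"
          have "r * ln 2 \<le> Re \<rho> * ln (real n)" using \<sigma> n elim(6) by (intro mult_mono) auto
          then show "norm (exp (- \<rho> * of_real (ln (real n)))) \<le> exp (- (r * ln 2))"
            unfolding nterm by simp
        qed
        also have "\<dots> = (real N - 1) * exp (- (r * ln 2))" using N by (simp add: of_nat_diff)
        also have "\<dots> \<le> 2 * r * exp (- (r * ln 2))" using N by (intro mult_right_mono) auto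
        also have "\<dots> < 1/4" by (rule elim(3))
        finally have tail: "norm (\<Sum>n=2..N. exp (- \<rho> * of_real (ln (real n)))) < 1/4" .
        have "(\<Sum>n=1..N. exp (- \<rho> * of_real (ln (real n)))) = 1 + (\<Sum>n=2..N. exp (- \<rho> * of_real (ln (real n))))"
          using N(1) by (simp add: sum.atLeast_Suc_atMost numeral_2_eq_2)
        then have "1 + ((\<Sum>n=2..N. exp (- \<rho> * of_real (ln (real n)))) + I) = 0"
          using sum by (simp only: add.assoc)
        then have "1 = - ((\<Sum>n=2..N. exp (- \<rho> * of_real (ln (real n)))) + I)"
          by (simp only: eq_neg_iff_add_eq_0)
        from arg_cong[OF this, of norm] show False
          using tail I4 norm_triangle_ineq[of "\<Sum>n=2..N. exp (- \<rho> * of_real (ln (real n)))" I]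
          unfolding norm_minus_cancel norm_one by linarith
      qed
      ultimately show "\<bar>saddle_height (ln r) \<delta>\<bar> < 1 / r" unfolding h_def by (simp add: abs_less_iff)
    qed
  qed
qed

lemma saddle_height_small_angle:
  "eventually (\<lambda>r. \<forall>\<delta>. 0 < \<delta> \<longrightarrow> \<delta> < pi / 2 \<longrightarrow> \<bar>saddle_height (ln r) \<delta>\<bar> < 1 / r \<longrightarrow>
     trial_angle 0 (ln r) < \<delta> \<and> \<delta> < trial_angle 1 (ln r)) at_top"
proof -
  have "eventually (\<lambda>r::real. ln r \<ge> 1) at_top" by real_asymp
  \<comment> \<open>This bound and the next keep the compared angles inside [0, pi/2], where the
    height is decreasing.\<close>
  moreover have "eventually (\<lambda>r. trial_angle 0 (ln r) < pi / 2) at_top"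
    unfolding trial_angle_def by real_asymp
  moreover have "eventually (\<lambda>r. trial_angle 1 (ln r) > 0) at_top"
    unfolding trial_angle_def by real_asymp
  moreover note eventually_saddle_height_lower eventually_saddle_height_upper
  ultimately show ?thesis
  proof eventually_elim
    case (elim r)
    show ?case
    proof (intro allI impI conjI)
      fix \<delta> assume \<delta>: "0 < \<delta>" "\<delta> < pi / 2" "\<bar>saddle_height (ln r) \<delta>\<bar> < 1 / r"
      show "trial_angle 0 (ln r) < \<delta>"
      proof (rule ccontr)
        assume "\<not> trial_angle 0 (ln r) < \<delta>"
        then have "saddle_height (ln r) (trial_angle 0 (ln r)) \<le> saddle_height (ln r) \<delta>"
          using saddle_height_strict_antimono[OF elim(1), of \<delta> "trial_angle 0 (ln r)"] \<delta> elim(2)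
          by (cases "\<delta> = trial_angle 0 (ln r)") auto
        then show False using elim(4) \<delta>(3) by (simp add: abs_less_iff)
      qed
      show "\<delta> < trial_angle 1 (ln r)"
      proof (rule ccontr)
        assume "\<not> \<delta> < trial_angle 1 (ln r)"
        then have "saddle_height (ln r) \<delta> \<le> saddle_height (ln r) (trial_angle 1 (ln r))"
          using saddle_height_strict_antimono[OF elim(1), of "trial_angle 1 (ln r)" \<delta>] \<delta> elim(3)
          by (cases "\<delta> = trial_angle 1 (ln r)") auto
        then show False using elim(5) \<delta>(3) by (simp add: abs_less_iff)
      qed
    qed
  qed
qed

theorem proposition1:
  fixes c :: real
  assumes "0 < c" and "c < 1"
  shows "\<exists>R>0. \<forall>\<rho>::complex.
           riemann_aux c \<rho> = 0 \<and> Re \<rho> > 0 \<and> Im \<rho> < 0 \<and> cmod \<rho> > R \<longrightarrow>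
             (\<exists>r \<epsilon> :: real. r > 0 \<and> 0 < \<epsilon> \<and> \<epsilon> < 1 \<and>
                \<rho> = of_real (2 * pi * r\<^sup>2) *
                    exp (\<i> * of_real (- pi / 2 + pi / (2 * ln r)
                                      - pi ^ 3 / (24 * ln r ^ 3)
                                      + pi ^ 3 * \<epsilon> / (24 * ln r ^ 4))))"
proof -
  have "eventually (\<lambda>r. \<forall>\<rho> \<delta>. 0 < \<delta> \<longrightarrow> \<delta> < pi / 2 \<longrightarrow>
     \<rho> = of_real (2 * pi * r\<^sup>2) * cis (- (pi / 2) + \<delta>) \<longrightarrow> riemann_aux c \<rho> = 0 \<longrightarrow>
     ln r > 0 \<and> trial_angle 0 (ln r) < \<delta> \<and> \<delta> < trial_angle 1 (ln r)) at_top"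
    using zero_saddle_height_small[OF assms] saddle_height_small_angle eventually_gt_at_top[of 1]
    by eventually_elim auto
  then obtain r0 where r0: "\<forall>r\<ge>r0. \<forall>\<rho> \<delta>. 0 < \<delta> \<longrightarrow> \<delta> < pi / 2 \<longrightarrow>
     \<rho> = of_real (2 * pi * r\<^sup>2) * cis (- (pi / 2) + \<delta>) \<longrightarrow> riemann_aux c \<rho> = 0 \<longrightarrow>
     ln r > 0 \<and> trial_angle 0 (ln r) < \<delta> \<and> \<delta> < trial_angle 1 (ln r)"
    unfolding eventually_at_top_linorder by (rule exE)
  show ?thesis
  \<comment> \<open>Because |\<rho>| = 2 pi r^2, exceeding this bound means r > max r0 1.\<close>
  proof (rule exI[of _ "2 * pi * (max r0 1)\<^sup>2"], intro conjI allI impI)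
    show "2 * pi * (max r0 1)\<^sup>2 > 0" by auto
    fix \<rho> :: complex
    assume \<rho>: "riemann_aux c \<rho> = 0 \<and> Re \<rho> > 0 \<and> Im \<rho> < 0 \<and> cmod \<rho> > 2 * pi * (max r0 1)\<^sup>2"
    then obtain r \<delta> where r: "r > 0" and \<delta>: "0 < \<delta>" "\<delta> < pi / 2" and cm: "cmod \<rho> = 2 * pi * r\<^sup>2"
      and eq: "\<rho> = of_real (2 * pi * r\<^sup>2) * cis (- (pi / 2) + \<delta>)"
      using fourth_quadrant_polar[of \<rho>] by blast
    have "(max r0 1)\<^sup>2 < r\<^sup>2" using \<rho> cm by simp
    then have "max r0 1 < r" by (rule power2_less_imp_less) (use r in simp)
    then have L: "ln r > 0" and lo: "trial_angle 0 (ln r) < \<delta>" and hi: "\<delta> < trial_angle 1 (ln r)"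
      using r0[rule_format, OF _ \<delta> eq] \<rho> by auto
    \<comment> \<open>The trial angle is affine and increasing in its parameter, so \<delta> lying
      between the values at 0 and 1 determines this \<epsilon> strictly between 0 and 1.\<close>
    define \<epsilon> where "\<epsilon> = (\<delta> - trial_angle 0 (ln r)) * (24 * ln r ^ 4) / pi ^ 3"
    have tr: "trial_angle e (ln r) = trial_angle 0 (ln r) + pi ^ 3 * e / (24 * ln r ^ 4)" for e
      by (simp add: trial_angle_def)
    have \<delta>_eq: "\<delta> = trial_angle \<epsilon> (ln r)" unfolding tr[of \<epsilon>] using L by (simp add: \<epsilon>_def)
    have "\<epsilon> > 0" using lo L by (simp add: \<epsilon>_def)
    moreover have "\<epsilon> < 1" using hi L unfolding tr[of 1] \<epsilon>_def by (simp add: field_simps)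
    moreover have "\<rho> = of_real (2 * pi * r\<^sup>2) *
                    exp (\<i> * of_real (- pi / 2 + pi / (2 * ln r)
                                      - pi ^ 3 / (24 * ln r ^ 3)
                                      + pi ^ 3 * \<epsilon> / (24 * ln r ^ 4)))"
    proof -
      have "- (pi / 2) + \<delta> = - pi / 2 + pi / (2 * ln r) - pi ^ 3 / (24 * ln r ^ 3) + pi ^ 3 * \<epsilon> / (24 * ln r ^ 4)"
        unfolding \<delta>_eq trial_angle_def by simp
      then show ?thesis unfolding eq cis_conv_exp by (simp only:)
    qed
    ultimately show "\<exists>r \<epsilon> :: real. r > 0 \<and> 0 < \<epsilon> \<and> \<epsilon> < 1 \<and>
                \<rho> = of_real (2 * pi * r\<^sup>2) *
                    exp (\<i> * of_real (- pi / 2 + pi / (2 * ln r)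
                                      - pi ^ 3 / (24 * ln r ^ 3)
                                      + pi ^ 3 * \<epsilon> / (24 * ln r ^ 4)))"
      using r by blast
  qed
qed

end
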